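(* Let $(\Omega,\mathcal F,(\mathcal F_t)_{t\in\mathbb R_+})$ be a filtered space with right-continuous filtration and $\mathcal F=\bigvee_t\mathcal F_t$, let $\mu,\nu$ be two probability measures on it, and let $Q=\frac12(\mu+\nu)$. Let $z,z',S$ and the Hellinger process $h(1)$ of order $1$ be as defined in the context. Set $N_1=\{0<S<\infty,\ z'_S=0<z'_{S-}\}$ and $$H_1=\operatorname{ess\,inf}\{W:\ W\text{ is a stopping time such that }N_1\in\mathcal F_W\text{ and }W_{N_1}=S_{N_1}\ Q\text{-a.s.}\}$$ Then $H_1$ is the stopping time of the process $h(1)$.
   Context: Stopping times take values in $[0,\infty]$. Equalities and inclusions of sets are understood up to $Q$-null sets; the essential infimum is with respect to $Q$. $z$ and $z'$ are the right-continuous versions with left limits of the density processes of $\mu$ and $\nu$ with respect to $Q$ ($z_t=d\mu_t/dQ_t$, $z'_t=d\nu_t/dQ_t$, where the subscript $t$ on a measure is restriction to $\mathcal F_t$). Convention: $z_{0-}=z_0$, $z_{t-}=\lim_{s\uparrow t}z_s$, similarly for $z'$. $S=\inf\{t: z_t=0\text{ or }z'_t=0\}$, with $\inf\varnothing=\infty$. The Hellinger process $h(1)$ of order $1$ is the $Q$-compensator (dual predictable projection) of the process $$A^1=\frac{z_S}{z_{S-}}\,1_{\{0<S<\infty,\ z'_S=0<z'_{S-}\}}\,1_{[S,\infty[}\qquad(0/0=0),$$ where $[S,\infty[$ is the stochastic interval. A stopping time $T$ is called the stopping time of a process $X$ if (1) $X=X^T$ (where $X^T_t=X_{t\wedge T}$),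 and (2) whenever $X=X^U$ for a stopping time $U$, then $T\le U$ $Q$-a.s. For a stopping time $T$ and $E\in\mathcal F_T$, $T_E$ is the stopping time equal to $T$ on $E$ and $+\infty$ off $E$. *)

theory Defs
  imports "HOL-Probability.Probability"
begin

text \<open>
  The time set is \<^typ>\<open>ennreal\<close>, so that the library notions \<^const>\<open>filtration\<close>, \<^const>\<open>stopping_time\<close>
  and \<^const>\<open>filtration.pre_sigma\<close> give stopping times with values in \<open>[0,\<infinity>]\<close> and their
  sigma-algebras. The member \<open>F \<infinity>\<close> of the family plays the role of the ambient sigma-algebra;
  processes only matter at finite times. The filtration is not assumed to be complete, hence
  path properties and identities hold almost surely with respect to \<open>Q\<close>.
\<close>

definition filtered_space :: "'a set \<Rightarrow> (ennreal \<Rightarrow> 'a measure) \<Rightarrow> bool" where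
  "filtered_space \<Omega> F \<longleftrightarrow>
     filtration \<Omega> F \<and>
     (\<forall>t<\<infinity>. sets (F t) = (\<Inter>u\<in>{t<..}. sets (F u))) \<and>
     sets (F \<infinity>) = sigma_sets \<Omega> (\<Union>t\<in>{..<\<infinity>}. sets (F t))"

definition mean_measure :: "'a measure \<Rightarrow> 'a measure \<Rightarrow> 'a measure" where
  "mean_measure \<mu> \<nu> = measure_of (space \<mu>) (sets \<mu>) (\<lambda>A. (emeasure \<mu> A + emeasure \<nu> A) / 2)"

definition cadlag_path :: "(ennreal \<Rightarrow> real) \<Rightarrow> bool" where
  "cadlag_path x \<longleftrightarrow>
     (\<forall>t<\<infinity>. continuous (at_right t) x \<and> (0 < t \<longrightarrow> (\<exists>l. (x \<longlongrightarrow> l) (at_left t))))"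

definition density_process ::
  "'a measure \<Rightarrow> (ennreal \<Rightarrow> 'a measure) \<Rightarrow> 'a measure \<Rightarrow> (ennreal \<Rightarrow> 'a \<Rightarrow> real) \<Rightarrow> bool" where
  "density_process Q F \<mu> z \<longleftrightarrow>
     (\<forall>t<\<infinity>. z t \<in> borel_measurable (F t) \<and> (AE \<omega> in Q. 0 \<le> z t \<omega>) \<and>
        density (restr_to_subalg Q (F t)) (\<lambda>\<omega>. ennreal (z t \<omega>)) = restr_to_subalg \<mu> (F t)) \<and>
     (AE \<omega> in Q. cadlag_path (\<lambda>t. z t \<omega>))"

definition left_limit :: "(ennreal \<Rightarrow> 'a \<Rightarrow> real) \<Rightarrow> ennreal \<Rightarrow> 'a \<Rightarrow> real" where
  "left_limit X t \<omega> = (if t = 0 then X 0 \<omega> else Lim (at_left t) (\<lambda>s. X s \<omega>))"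

definition zero_time ::
  "(ennreal \<Rightarrow> 'a \<Rightarrow> real) \<Rightarrow> (ennreal \<Rightarrow> 'a \<Rightarrow> real) \<Rightarrow> 'a \<Rightarrow> ennreal" where
  "zero_time z z' \<omega> = Inf {t. t < \<infinity> \<and> (z t \<omega> = 0 \<or> z' t \<omega> = 0)}"

definition N1 ::
  "'a set \<Rightarrow> (ennreal \<Rightarrow> 'a \<Rightarrow> real) \<Rightarrow> (ennreal \<Rightarrow> 'a \<Rightarrow> real) \<Rightarrow> 'a set" where
  "N1 \<Omega> z z' = {\<omega> \<in> \<Omega>. 0 < zero_time z z' \<omega> \<and> zero_time z z' \<omega> < \<infinity> \<and>
     z' (zero_time z z' \<omega>) \<omega> = 0 \<and> 0 < left_limit z' (zero_time z z' \<omega>) \<omega>}"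

definition A1 ::
  "'a set \<Rightarrow> (ennreal \<Rightarrow> 'a \<Rightarrow> real) \<Rightarrow> (ennreal \<Rightarrow> 'a \<Rightarrow> real) \<Rightarrow> ennreal \<Rightarrow> 'a \<Rightarrow> ennreal" where
  "A1 \<Omega> z z' t \<omega> =
     ennreal (z (zero_time z z' \<omega>) \<omega> / left_limit z (zero_time z z' \<omega>) \<omega>)
       * indicator (N1 \<Omega> z z') \<omega> * indicator {zero_time z z' \<omega>..} t"

definition predictable_sigma :: "'a set \<Rightarrow> (ennreal \<Rightarrow> 'a measure) \<Rightarrow> ('a \<times> ennreal) measure" where
  "predictable_sigma \<Omega> F = sigma (\<Omega> \<times> {..<\<infinity>})
     ({B \<times> {0} | B. B \<in> sets (F 0)} \<union>
      {B \<times> {s<..t} | B s t. B \<in> sets (F s) \<and> s \<le> t \<and> t < \<infinity>})"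

text \<open>
  Lebesgue-Stieltjes integral over \<open>]0,\<infinity>[\<close> against an increasing right-continuous path with
  values in \<open>[0,\<infinity>]\<close>: the measures induced by the truncations \<open>a \<and> n\<close> increase with \<open>n\<close> to a
  measure giving \<open>]0,t]\<close> the mass \<open>a t - a 0\<close> whenever \<open>a 0\<close> is finite. For paths that are
  finite on finite times this is the usual Stieltjes integral.
\<close>

definition stieltjes_nn_integral :: "(ennreal \<Rightarrow> ennreal) \<Rightarrow> (ennreal \<Rightarrow> ennreal) \<Rightarrow> ennreal" where
  "stieltjes_nn_integral a f =
     (SUP n::nat. \<integral>\<^sup>+r\<in>{0<..}. f (ennreal r)
        \<partial>interval_measure (\<lambda>r. enn2real (min (a (ennreal r)) (of_nat n))))"

text \<open>
  Dual predictable projection. Values in \<open>[0,\<infinity>]\<close> are allowed because the process \<^const>\<open>A1\<close> is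
  in general not locally integrable: its compensator may explode at \<open>S\<close> on \<open>z\<^sub>S\<^sub>- = 0\<close>.
\<close>

definition compensator ::
  "'a measure \<Rightarrow> (ennreal \<Rightarrow> 'a measure) \<Rightarrow> (ennreal \<Rightarrow> 'a \<Rightarrow> ennreal) \<Rightarrow> (ennreal \<Rightarrow> 'a \<Rightarrow> ennreal) \<Rightarrow> bool"
where
  "compensator Q F A h \<longleftrightarrow>
     (\<lambda>(\<omega>, t). h t \<omega>) \<in> borel_measurable (predictable_sigma (space Q) F) \<and>
     (AE \<omega> in Q. h 0 \<omega> = 0 \<and> mono_on {..<\<infinity>} (\<lambda>t. h t \<omega>) \<and>
        (\<forall>t<\<infinity>. continuous (at_right t) (\<lambda>s. h s \<omega>))) \<and>
     (\<forall>H \<in> borel_measurable (predictable_sigma (space Q) F).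
        (\<integral>\<^sup>+\<omega>. stieltjes_nn_integral (\<lambda>t. A t \<omega>) (\<lambda>t. H (\<omega>, t)) \<partial>Q) =
        (\<integral>\<^sup>+\<omega>. stieltjes_nn_integral (\<lambda>t. h t \<omega>) (\<lambda>t. H (\<omega>, t)) \<partial>Q))"

definition stopped_by :: "'a measure \<Rightarrow> (ennreal \<Rightarrow> 'a \<Rightarrow> ennreal) \<Rightarrow> ('a \<Rightarrow> ennreal) \<Rightarrow> bool" where
  "stopped_by Q X T \<longleftrightarrow> (AE \<omega> in Q. \<forall>t<\<infinity>. X t \<omega> = X (min t (T \<omega>)) \<omega>)"

definition stopping_time_of_process ::
  "'a measure \<Rightarrow> (ennreal \<Rightarrow> 'a measure) \<Rightarrow> (ennreal \<Rightarrow> 'a \<Rightarrow> ennreal) \<Rightarrow> ('a \<Rightarrow> ennreal) \<Rightarrow> bool" where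
  "stopping_time_of_process Q F X T \<longleftrightarrow>
     stopping_time F T \<and> stopped_by Q X T \<and>
     (\<forall>U. stopping_time F U \<longrightarrow> stopped_by Q X U \<longrightarrow> (AE \<omega> in Q. T \<omega> \<le> U \<omega>))"

definition restrict_time :: "('a \<Rightarrow> ennreal) \<Rightarrow> 'a set \<Rightarrow> 'a \<Rightarrow> ennreal" where
  "restrict_time T E \<omega> = (if \<omega> \<in> E then T \<omega> else \<infinity>)"

definition in_sets_mod_null :: "'a measure \<Rightarrow> 'a set \<Rightarrow> 'a measure \<Rightarrow> bool" where
  "in_sets_mod_null Q E G \<longleftrightarrow> (\<exists>B\<in>sets G. AE \<omega> in Q. \<omega> \<in> E \<longleftrightarrow> \<omega> \<in> B)"

definition H1_family ::
  "'a measure \<Rightarrow> (ennreal \<Rightarrow> 'a measure) \<Rightarrow> (ennreal \<Rightarrow> 'a \<Rightarrow> real) \<Rightarrow> (ennreal \<Rightarrow> 'a \<Rightarrow> real) \<Rightarrow>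
   ('a \<Rightarrow> ennreal) set" where
  "H1_family Q F z z' =
     {W. stopping_time F W \<and>
         in_sets_mod_null Q (N1 (space Q) z z') (filtration.pre_sigma (space Q) F W) \<and>
         (AE \<omega> in Q. restrict_time W (N1 (space Q) z z') \<omega> =
                      restrict_time (zero_time z z') (N1 (space Q) z z') \<omega>)}"

text \<open>The essential infimum of a family is only determined up to null sets.\<close>

definition is_ess_inf :: "'a measure \<Rightarrow> ('a \<Rightarrow> ennreal) set \<Rightarrow> ('a \<Rightarrow> ennreal) \<Rightarrow> bool" where
  "is_ess_inf Q \<W> H \<longleftrightarrow>
     H \<in> borel_measurable Q \<and> (\<forall>W\<in>\<W>. AE \<omega> in Q. H \<omega> \<le> W \<omega>) \<and>
     (\<forall>G\<in>borel_measurable Q. (\<forall>W\<in>\<W>. AE \<omega> in Q. G \<omega> \<le> W \<omega>) \<longrightarrow> (AE \<omega> in Q. G \<omega> \<le> H \<omega>))"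

end

theory Submission
  imports Defs
begin

text \<open>
  Write \<open>S\<close> for the zero time and \<open>N\<close> for \<open>N\<^sub>1\<close>. Nonnegative martingales are absorbed at zero, also
  when only their left limit vanishes. Since \<open>z + z' = 2\<close>, the process \<open>A\<^sup>1\<close> therefore has a jump of
  size \<open>2 / z\<^sub>S\<^sub>- \<ge> 1\<close> at \<open>S\<close> on \<open>N\<close>, and is constant elsewhere. Testing the compensator identity on the
  predictable rectangles \<open>{U \<le> s} \<times> ]s, t]\<close> with rational \<open>s < t\<close> shows that a stopping time \<open>U\<close>
  stops \<open>h(1)\<close> if and only if \<open>S \<le> U\<close> almost surely on \<open>N\<close>.

  The stopping times with this property are closed under countable infima, so they have a least
  element \<open>T\<close>, which is the stopping time of \<open>h(1)\<close>. They contain every member of the family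
  defining \<open>H\<^sub>1\<close>; conversely each such \<open>U\<close> dominates \<open>W = U \<and> S\<^sub>N\<close>, which belongs to that family
  because \<open>N = {S\<^sub>N \<le> U, S\<^sub>N < \<infinity>}\<close> lies in \<open>F\<^sub>W\<close> up to a null set. Hence \<open>T\<close> is the essential infimum.
\<close>

subsection \<open>Paths\<close>

text \<open>\<open>ennreal\<close> sends negative rationals to 0, so the image is exactly the set of
  nonnegative rationals: countable, dense, and without the point \<infinity>.\<close>

definition rat_times :: "ennreal set" where
  "rat_times = ennreal ` \<rat>"

lemma countable_rat_times: "countable rat_times"
  by (simp add: rat_times_def countable_rat)

lemma rat_times_finite: "q \<in> rat_times \<Longrightarrow> q < \<infinity>"
  by (auto simp: rat_times_def)

lemma rat_times_dense: "(a::ennreal) < b \<Longrightarrow> \<exists>q\<in>rat_times. a < q \<and> q < b"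
  using ennreal_rat_dense[of a b] by (auto simp: rat_times_def)

lemma ennreal_eventually_at_right:
  fixes t :: ennreal
  assumes "t < \<infinity>"
  shows "eventually P (at_right t) \<longleftrightarrow> (\<exists>b>t. \<forall>s. t < s \<longrightarrow> s < b \<longrightarrow> P s)"
  using eventually_at_right[OF assms] by auto

lemma ennreal_eventually_at_left:
  fixes t :: ennreal
  assumes "0 < t"
  shows "eventually P (at_left t) \<longleftrightarrow> (\<exists>b<t. \<forall>s. b < s \<longrightarrow> s < t \<longrightarrow> P s)"
  using eventually_at_left[OF assms] by auto

lemma ennreal_at_left_neq_bot: "0 < (t::ennreal) \<Longrightarrow> at_left t \<noteq> bot"
  unfolding trivial_limit_def ennreal_eventually_at_left by (meson dense)

text \<open>If \<open>f t\<close> lay in the open complement of \<open>C\<close>, right continuity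
  would keep \<open>f\<close> there shortly after \<open>t\<close>, in particular at a rational
  time. This is the device that carries conditions from countably many times to all times.\<close>

lemma rat_times_right_limit_in_closed:
  fixes f :: "ennreal \<Rightarrow> 'b::topological_space"
  assumes "t < \<infinity>" "t < u" "continuous (at_right t) f" "closed C"
    and f: "\<And>q. q \<in> rat_times \<Longrightarrow> t < q \<Longrightarrow> q < u \<Longrightarrow> f q \<in> C"
  shows "f t \<in> C"
proof (rule ccontr)
  assume "f t \<notin> C"
  moreover have "(f \<longlongrightarrow> f t) (at_right t)"
    using assms(3) by (simp add: continuous_within)
  ultimately have "eventually (\<lambda>s. f s \<in> - C) (at_right t)"
    using \<open>closed C\<close> by (intro topological_tendstoD) auto
  then obtain b where b: "t < b" "\<And>s. t < s \<Longrightarrow> s < b \<Longrightarrow> f s \<notin> C"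
    using assms(1) by (auto simp: ennreal_eventually_at_right)
  obtain q where "q \<in> rat_times" "t < q" "q < min b u"
    using rat_times_dense[of t "min b u"] b(1) assms(2) by auto
  with b f show False by auto
qed

lemma rat_times_right_limit_less:
  fixes x :: "ennreal \<Rightarrow> real"
  assumes "t < \<infinity>" "continuous (at_right t) x" "x t < e" "t < u"
  shows "\<exists>q\<in>rat_times. t < q \<and> q < u \<and> x q < e"
proof (rule ccontr)
  assume "\<not> ?thesis"
  then have "x t \<in> {e..}"
    by - (rule rat_times_right_limit_in_closed[OF assms(1,4,2)]; auto)
  with assms(3) show False by simp
qed

text \<open>Only rational times occur, so that a countable union of null sets suffices to have this
  almost surely. For a nonnegative path, arbitrarily small values up to \<open>t\<close> cover both
  a visit to zero and a vanishing left limit.\<close>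

definition zero_absorbing :: "(ennreal \<Rightarrow> real) \<Rightarrow> bool" where
  "zero_absorbing x \<longleftrightarrow>
     (\<forall>t\<in>rat_times. (\<forall>e>0. \<exists>q\<in>rat_times. q \<le> t \<and> x q < e) \<longrightarrow> x t = 0)"

text \<open>Right continuity at \<open>s\<close> gives arbitrarily small values at rational times
  just after \<open>s\<close>, so the path vanishes at every rational time after \<open>t\<close>;
  right continuity at \<open>t\<close> then gives the value there.\<close>

lemma zero_absorbingD:
  assumes "cadlag_path x" "zero_absorbing x" "x s = 0" "s \<le> t" "t < \<infinity>"
  shows "x t = 0"
proof (cases "s = t")
  case False
  with assms have "s < t" by simp
  then have "s < \<infinity>" using assms(5) by (rule less_trans)
  have rc: "continuous (at_right r) x" if "r < \<infinity>" for r
    using assms(1) that unfolding cadlag_path_def by blast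
  have "x q = 0" if q: "q \<in> rat_times" "t < q" for q
  proof -
    have "\<exists>p\<in>rat_times. p \<le> q \<and> x p < e" if e: "0 < e" for e
    proof -
      obtain p where "p \<in> rat_times" "p < q" "x p < e"
        using rat_times_right_limit_less[OF \<open>s < \<infinity>\<close> rc[OF \<open>s < \<infinity>\<close>], of e q] assms(3) e less_trans[OF \<open>s < t\<close> q(2)]
        by metis
      then show ?thesis by (meson less_imp_le)
    qed
    then show ?thesis
      using assms(2) q(1) unfolding zero_absorbing_def by simp
  qed
  then have "x t \<in> {0}"
    using \<open>t < \<infinity>\<close> by - (rule rat_times_right_limit_in_closed[of t \<infinity> x]; simp add: rc)
  then show ?thesis by simp
qed (use assms in simp)

lemma left_limit_tendsto:
  assumes "cadlag_path (\<lambda>t. X t \<omega>)" "0 < s" "s < \<infinity>"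
  shows "((\<lambda>t. X t \<omega>) \<longlongrightarrow> left_limit X s \<omega>) (at_left s)"
proof -
  obtain l where l: "((\<lambda>t. X t \<omega>) \<longlongrightarrow> l) (at_left s)"
    using assms unfolding cadlag_path_def by blast
  from l have "Lim (at_left s) (\<lambda>t. X t \<omega>) = l"
    using ennreal_at_left_neq_bot[OF assms(2)] by (intro tendsto_Lim) simp_all
  with l show ?thesis
    using assms(2) by (auto simp: left_limit_def)
qed

text \<open>Here the small values come from rational times just before \<open>s\<close>; they force
  zeros at all rational times after \<open>s\<close>, hence at \<open>s\<close> by right
  continuity.\<close>

lemma zero_absorbing_left_limit:
  assumes "cadlag_path (\<lambda>t. X t \<omega>)" "zero_absorbing (\<lambda>t. X t \<omega>)" "0 < s" "s < \<infinity>"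
    and "left_limit X s \<omega> = 0"
  shows "X s \<omega> = 0"
proof -
  have "X q \<omega> = 0" if q: "q \<in> rat_times" "s < q" for q
  proof -
    have "\<exists>p\<in>rat_times. p \<le> q \<and> X p \<omega> < e" if "0 < e" for e
    proof -
      have "eventually (\<lambda>t. X t \<omega> < e) (at_left s)"
        using left_limit_tendsto[of X \<omega>, OF assms(1,3,4)] that assms(5) by (intro order_tendstoD(2)) auto
      then obtain b where "b < s" "\<And>t. b < t \<Longrightarrow> t < s \<Longrightarrow> X t \<omega> < e"
        using assms(3) by (auto simp: ennreal_eventually_at_left)
      moreover obtain p where "p \<in> rat_times" "b < p" "p < s"
        using rat_times_dense[OF \<open>b < s\<close>] by auto
      ultimately show ?thesis
        using q by (intro bexI[of _ p]) auto
    qed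
    then show ?thesis
      using assms(2) q(1) unfolding zero_absorbing_def by simp
  qed
  then have "X s \<omega> \<in> {0}"
    using assms unfolding cadlag_path_def
    by - (rule rat_times_right_limit_in_closed[of s \<infinity> "\<lambda>t. X t \<omega>"]; auto)
  then show ?thesis by simp
qed

text \<open>Collects the almost sure properties of the two density paths, so that the study of
  \<open>zero_time\<close> and \<open>N1\<close> can be done for one fixed path.\<close>

definition regular_pair ::
  "(ennreal \<Rightarrow> 'a \<Rightarrow> real) \<Rightarrow> (ennreal \<Rightarrow> 'a \<Rightarrow> real) \<Rightarrow> 'a \<Rightarrow> bool" where
  "regular_pair z z' \<omega> \<longleftrightarrow>
     cadlag_path (\<lambda>t. z t \<omega>) \<and> cadlag_path (\<lambda>t. z' t \<omega>) \<and>
     zero_absorbing (\<lambda>t. z t \<omega>) \<and> zero_absorbing (\<lambda>t. z' t \<omega>) \<and>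
     (\<forall>t<\<infinity>. 0 \<le> z t \<omega> \<and> 0 \<le> z' t \<omega> \<and> z t \<omega> + z' t \<omega> = 2)"

lemma regular_pairI_rat:
  assumes "cadlag_path (\<lambda>t. z t \<omega>)" "cadlag_path (\<lambda>t. z' t \<omega>)"
    and "zero_absorbing (\<lambda>t. z t \<omega>)" "zero_absorbing (\<lambda>t. z' t \<omega>)"
    and q: "\<And>q. q \<in> rat_times \<Longrightarrow> 0 \<le> z q \<omega> \<and> 0 \<le> z' q \<omega> \<and> z q \<omega> + z' q \<omega> = 2"
  shows "regular_pair z z' \<omega>"
  unfolding regular_pair_def
proof (intro conjI allI impI assms(1-4))
  fix t :: ennreal assume t: "t < \<infinity>"
  have c: "continuous (at_right t) (\<lambda>t. z t \<omega>)" "continuous (at_right t) (\<lambda>t. z' t \<omega>)"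
    using assms t by (auto simp: cadlag_path_def)
  have "z t \<omega> \<in> {0..}"
    using q by - (rule rat_times_right_limit_in_closed[OF t t c(1)]; auto)
  then show "0 \<le> z t \<omega>" by simp
  have "z' t \<omega> \<in> {0..}"
    using q by - (rule rat_times_right_limit_in_closed[OF t t c(2)]; auto)
  then show "0 \<le> z' t \<omega>" by simp
  have "z t \<omega> + z' t \<omega> \<in> {2}"
    using q by - (rule rat_times_right_limit_in_closed[OF t t continuous_add[OF c]]; auto)
  then show "z t \<omega> + z' t \<omega> = 2" by simp
qed

section \<open>The first zero of a regular pair of paths\<close>

context
  fixes z z' :: "ennreal \<Rightarrow> 'a \<Rightarrow> real" and \<omega> :: 'a
  assumes reg: "regular_pair z z' \<omega>"
begin

text \<open>The infimum is attained: if the product of both paths were nonzero there, right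
  continuity would keep it nonzero up to some later \<open>b\<close>, and \<open>b\<close> would be
  a larger lower bound of the zeros.\<close>

lemma zero_at_zero_time:
  assumes "zero_time z z' \<omega> < \<infinity>"
  shows "z (zero_time z z' \<omega>) \<omega> = 0 \<or> z' (zero_time z z' \<omega>) \<omega> = 0"
proof (rule ccontr)
  let ?S = "zero_time z z' \<omega>"
  let ?Z = "{t. t < \<infinity> \<and> (z t \<omega> = 0 \<or> z' t \<omega> = 0)}"
  assume *: "\<not> (z ?S \<omega> = 0 \<or> z' ?S \<omega> = 0)"
  have "((\<lambda>t. z t \<omega> * z' t \<omega>) \<longlongrightarrow> z ?S \<omega> * z' ?S \<omega>) (at_right ?S)"
    using reg assms unfolding regular_pair_def cadlag_path_def continuous_within
    by (intro tendsto_mult) auto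
  then have "eventually (\<lambda>t. z t \<omega> * z' t \<omega> \<noteq> 0) (at_right ?S)"
    using * by (intro tendsto_imp_eventually_ne) auto
  then obtain b where b: "?S < b" "\<And>t. ?S < t \<Longrightarrow> t < b \<Longrightarrow> z t \<omega> * z' t \<omega> \<noteq> 0"
    using assms by (auto simp: ennreal_eventually_at_right)
  have "b \<le> t" if "t \<in> ?Z" for t
  proof (rule ccontr)
    assume "\<not> b \<le> t"
    moreover have "?S \<le> t"
      using that unfolding zero_time_def by (rule Inf_lower)
    moreover have "?S \<noteq> t"
      using that * by auto
    ultimately show False
      using that b(2)[of t, OF le_neq_trans] by (auto simp: not_le)
  qed
  then have "b \<le> ?S"
    unfolding zero_time_def by (rule Inf_greatest)
  with b(1) show False by simp
qed

text \<open>On \<open>N1\<close> the sum condition gives \<open>z\<close> the value 2 at the zero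
  time, while its left limit is at most 2. The left limit is not 0, since absorption would then make
  the value 0; this matters because division by 0 yields 0.\<close>

lemma N1_jump:
  assumes "\<omega> \<in> N1 \<Omega> z z'"
  shows "1 \<le> z (zero_time z z' \<omega>) \<omega> / left_limit z (zero_time z z' \<omega>) \<omega>"
proof -
  let ?S = "zero_time z z' \<omega>"
  have S: "0 < ?S" "?S < \<infinity>" "z' ?S \<omega> = 0"
    using assms by (auto simp: N1_def)
  with reg have z: "z ?S \<omega> = 2" by (auto simp: regular_pair_def)
  have c: "cadlag_path (\<lambda>t. z t \<omega>)" "zero_absorbing (\<lambda>t. z t \<omega>)"
    using reg by (auto simp: regular_pair_def)
  have l: "((\<lambda>t. z t \<omega>) \<longlongrightarrow> left_limit z ?S \<omega>) (at_left ?S)"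
    using c S by (intro left_limit_tendsto) auto
  have "\<forall>t<\<infinity>. 0 \<le> z t \<omega> \<and> z t \<omega> \<le> 2"
    using reg unfolding regular_pair_def by (smt (verit))
  then have ev: "eventually (\<lambda>t. 0 \<le> z t \<omega> \<and> z t \<omega> \<le> 2) (at_left ?S)"
    using S by (auto simp: ennreal_eventually_at_left intro!: exI[of _ 0])
  have "0 \<le> left_limit z ?S \<omega>"
    by (rule tendsto_lowerbound[OF l _ ennreal_at_left_neq_bot[OF S(1)]])
       (use ev in \<open>auto elim: eventually_mono\<close>)
  moreover have "left_limit z ?S \<omega> \<le> 2"
    by (rule tendsto_upperbound[OF l _ ennreal_at_left_neq_bot[OF S(1)]])
       (use ev in \<open>auto elim: eventually_mono\<close>)
  moreover have "left_limit z ?S \<omega> \<noteq> 0"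
    using zero_absorbing_left_limit[of z \<omega>, OF c S(1,2)] z by auto
  ultimately show ?thesis
    using z by (simp add: field_simps)
qed

text \<open>
  Absorption at zero makes the event below depend on \<open>z'\<close> at countably many times before \<open>t\<close>
  only: \<open>z'\<close> has reached zero by a jump, that is, it stayed away from zero on some interval
  \<open>[p, S[\<close>.
\<close>

lemma N1_before_iff:
  assumes "\<omega> \<in> \<Omega>" "t < \<infinity>"
  shows "\<omega> \<in> N1 \<Omega> z z' \<and> zero_time z z' \<omega> < t \<longleftrightarrow>
    (\<exists>q\<in>rat_times. q < t \<and> z' q \<omega> = 0) \<and>
    (\<exists>n::nat. \<exists>p\<in>rat_times. p < t \<and> 0 < z' p \<omega> \<and>
       (\<forall>q\<in>rat_times. p \<le> q \<and> q < t \<longrightarrow> z' q \<omega> = 0 \<or> 1 / Suc n \<le> z' q \<omega>))"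
    (is "?L \<longleftrightarrow> ?R1 \<and> ?R2")
proof -
  let ?S = "zero_time z z' \<omega>"
  have c: "cadlag_path (\<lambda>t. z t \<omega>)" "cadlag_path (\<lambda>t. z' t \<omega>)"
    "zero_absorbing (\<lambda>t. z t \<omega>)" "zero_absorbing (\<lambda>t. z' t \<omega>)"
    using reg by (auto simp: regular_pair_def)
  have nn: "0 \<le> z' t \<omega>" "z t \<omega> + z' t \<omega> = 2" if "t < \<infinity>" for t
    using reg that by (auto simp: regular_pair_def)
  have S_le: "?S \<le> t" if "t < \<infinity>" "z' t \<omega> = 0" for t
    using that unfolding zero_time_def by (auto intro: Inf_lower)
  show ?thesis
  proof
    assume L: ?L
    then have S: "0 < ?S" "?S < \<infinity>" "?S < t" "z' ?S \<omega> = 0" "0 < left_limit z' ?S \<omega>"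
      by (auto simp: N1_def)
    have R1: ?R1
    proof -
      obtain q where q: "q \<in> rat_times" "?S < q" "q < t"
        using rat_times_dense[OF S(3)] by auto
      then show ?thesis
        using zero_absorbingD[OF c(2,4) S(4), of q] assms(2) by auto
    qed
    \<comment> \<open>The threshold is taken below the left limit, so \<open>z'\<close> exceeds it
      from some rational \<open>p\<close> up to the zero time and is 0 from then on.\<close>
    obtain n :: nat where n: "1 / Suc n < left_limit z' ?S \<omega>"
      using nat_approx_posE[OF S(5)] by blast
    have "eventually (\<lambda>t. 1 / Suc n < z' t \<omega>) (at_left ?S)"
      using left_limit_tendsto[of z' \<omega>, OF c(2) S(1,2)] n by (rule order_tendstoD(1))
    then obtain b where b: "b < ?S" "\<And>t. b < t \<Longrightarrow> t < ?S \<Longrightarrow> 1 / Suc n < z' t \<omega>"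
      using S by (auto simp: ennreal_eventually_at_left)
    obtain p where p: "p \<in> rat_times" "b < p" "p < ?S"
      using rat_times_dense[OF b(1)] by auto
    have "z' q \<omega> = 0 \<or> 1 / Suc n \<le> z' q \<omega>" if "p \<le> q" "q < t" for q
    proof (cases "?S \<le> q")
      case True
      then show ?thesis
        using zero_absorbingD[OF c(2,4) S(4), of q] that assms(2) by auto
    next
      case False
      then show ?thesis
        using b(2)[of q] less_le_trans[OF p(2) that(1)] by (auto simp: not_le)
    qed
    moreover have "0 < z' p \<omega>"
      using b(2)[OF p(2,3)] by (rule le_less_trans[rotated]) simp
    ultimately have ?R2
      using p S(3) by (intro exI[of _ n] bexI[of _ p]) auto
    with R1 show "?R1 \<and> ?R2" by blast
  next
    assume R: "?R1 \<and> ?R2"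
    from R obtain q where q: "q \<in> rat_times" "q < t" "z' q \<omega> = 0" by blast
    from R obtain n :: nat and p where p: "p \<in> rat_times" "p < t" "0 < z' p \<omega>"
      and away: "\<And>q. q \<in> rat_times \<Longrightarrow> p \<le> q \<Longrightarrow> q < t \<Longrightarrow> z' q \<omega> = 0 \<or> 1 / Suc n \<le> z' q \<omega>"
      by blast
    have Sq: "?S \<le> q"
      using q by (intro S_le rat_times_finite) auto
    then have S: "?S < t" "?S < \<infinity>"
      using q assms(2) by auto
    \<comment> \<open>Otherwise \<open>z\<close> is the path that vanishes first; it stays 0 up to
      \<open>q\<close>, where \<open>z'\<close> is 0 as well, against the sum 2.\<close>
    have z'0: "z' ?S \<omega> = 0"
    proof (rule ccontr)
      assume "z' ?S \<omega> \<noteq> 0"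
      then have "z ?S \<omega> = 0"
        using zero_at_zero_time S by blast
      then have "z q \<omega> = 0"
        using zero_absorbingD[OF c(1,3) _ Sq] rat_times_finite[OF q(1)] by simp
      then show False
        using nn(2)[OF rat_times_finite[OF q(1)]] q(3) by simp
    qed
    have pS: "p < ?S"
      using zero_absorbingD[OF c(2,4) z'0, of p] p(3) rat_times_finite[OF p(1)]
      by (cases "?S \<le> p") auto
    then have S0: "0 < ?S"
      by (rule le_less_trans[OF zero_le])
    \<comment> \<open>A smaller left limit would give a rational time between \<open>p\<close> and
      the zero time at which \<open>z'\<close> is nonzero and below the threshold, which the choice
      of \<open>p\<close> excludes.\<close>
    have "1 / Suc n \<le> left_limit z' ?S \<omega>"
    proof (rule ccontr)
      assume "\<not> ?thesis"
      then have "eventually (\<lambda>t. z' t \<omega> < 1 / Suc n) (at_left ?S)"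
        using left_limit_tendsto[of z' \<omega>, OF c(2) S0 S(2)] by (intro order_tendstoD(2)) auto
      then obtain b where b: "b < ?S" "\<And>t. b < t \<Longrightarrow> t < ?S \<Longrightarrow> z' t \<omega> < 1 / Suc n"
        using S0 by (auto simp: ennreal_eventually_at_left)
      obtain r where r: "r \<in> rat_times" "max b p < r" "r < ?S"
        using rat_times_dense[of "max b p" ?S] b(1) pS by auto
      have "z' r \<omega> \<noteq> 0"
        using S_le[OF rat_times_finite[OF r(1)]] r by auto
      then show False
        using away[OF r(1) less_imp_le[of p r] less_trans[OF r(3) S(1)]] r b(2)[of r] by simp
    qed
    then have "0 < left_limit z' ?S \<omega>"
      by (rule less_le_trans[rotated]) simp
    with S S0 z'0 assms(1) show ?L
      by (auto simp: N1_def)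
  qed
qed

end

subsection \<open>Stopping times\<close>

locale right_continuous_filtration = prob_space Q + filtration \<Omega> F
  for Q :: "'a measure" and \<Omega> :: "'a set" and F :: "ennreal \<Rightarrow> 'a measure" +
  assumes sets_Q: "sets Q = sets (F \<infinity>)"
    and sets_F_right: "t < \<infinity> \<Longrightarrow> sets (F t) = (\<Inter>u\<in>{t<..}. sets (F u))"
begin

lemma space_Q: "space Q = \<Omega>"
  using sets_eq_imp_space_eq[OF sets_Q] by (simp add: space_F)

lemma subalgebra_F: "sets M = sets (F \<infinity>) \<Longrightarrow> subalgebra M (F t)"
  using sets_F_mono[of t \<infinity>] sets_eq_imp_space_eq[of M "F \<infinity>"] by (simp add: subalgebra_def space_F)

lemma stopping_time_measurable: "stopping_time F T \<Longrightarrow> T \<in> borel_measurable Q"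
  using sets_F_mono[OF top_greatest]
  by (intro measurable_stopping_time[of F]) (simp_all add: sets_Q space_F space_Q)

text \<open>For every \<open>u > t\<close> the event \<open>T \<le> t\<close> is the intersection of
  the events \<open>T < q\<close> over rational \<open>q\<close> between \<open>t\<close> and
  \<open>u\<close>, so it lies in \<open>F u\<close>; right continuity of the filtration puts it
  into \<open>F t\<close>.\<close>

lemma stopping_timeI_rat_less:
  assumes T: "\<And>q. q \<in> rat_times \<Longrightarrow> {\<omega>\<in>\<Omega>. T \<omega> < q} \<in> sets (F q)"
  shows "stopping_time F T"
proof
  fix t :: ennreal
  show "Measurable.pred (F t) (\<lambda>\<omega>. T \<omega> \<le> t)"
  proof (cases "t < \<infinity>")
    case True
    have "{\<omega>\<in>\<Omega>. T \<omega> \<le> t} \<in> sets (F u)" if tu: "t < u" for u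
    proof -
      let ?D = "{q\<in>rat_times. t < q \<and> q < u}"
      \<comment> \<open>A nonempty index set keeps the intersection inside \<Omega>.\<close>
      obtain q0 where "q0 \<in> ?D"
        using rat_times_dense[OF tu] by auto
      have "{\<omega>\<in>\<Omega>. T \<omega> \<le> t} = (\<Inter>q\<in>?D. {\<omega>\<in>\<Omega>. T \<omega> < q})" (is "?l = ?r")
      proof
        show "?r \<subseteq> ?l"
        proof
          fix \<omega> assume \<omega>: "\<omega> \<in> ?r"
          have "T \<omega> \<le> t"
          proof (rule ccontr)
            assume "\<not> T \<omega> \<le> t"
            then obtain q where "q \<in> rat_times" "t < q" "q < min u (T \<omega>)"
              using rat_times_dense[of t "min u (T \<omega>)"] tu by (auto simp: not_le)
            with \<omega> show False by auto
          qed
          with \<omega> \<open>q0 \<in> ?D\<close> show "\<omega> \<in> ?l" by auto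
        qed
      qed auto
      also have "\<dots> \<in> sets (F u)"
      proof (rule sets.countable_INT')
        show "countable ?D"
          by (rule countable_subset[OF _ countable_rat_times]) auto
        show "?D \<noteq> {}"
          using \<open>q0 \<in> ?D\<close> by blast
        show "(\<lambda>q. {\<omega>\<in>\<Omega>. T \<omega> < q}) ` ?D \<subseteq> sets (F u)"
          using T sets_F_mono by (blast intro: less_imp_le)
      qed
      finally show ?thesis .
    qed
    then have "{\<omega>\<in>\<Omega>. T \<omega> \<le> t} \<in> (\<Inter>u\<in>{t<..}. sets (F u))"
      by blast
    then show ?thesis
      unfolding pred_def space_F sets_F_right[OF True] .
  qed (auto simp: less_top[symmetric])
qed

text \<open>The infimum is below \<open>t\<close> exactly when some \<open>B q\<close> with rational
  \<open>q < t\<close> occurs, and that event belongs to \<open>F t\<close>.\<close>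

lemma stopping_time_from_rat_events:
  assumes "\<And>q. q \<in> rat_times \<Longrightarrow> B q \<in> sets (F q)"
  shows "stopping_time F (\<lambda>\<omega>. Inf {q\<in>rat_times. \<omega> \<in> B q})"
proof (rule stopping_timeI_rat_less)
  fix t :: ennreal
  have "B q \<subseteq> \<Omega>" if "q \<in> rat_times" for q
    using sets.sets_into_space[OF assms[OF that]] by (simp add: space_F)
  then have "{\<omega>\<in>\<Omega>. Inf {q\<in>rat_times. \<omega> \<in> B q} < t} = (\<Union>q\<in>{q\<in>rat_times. q < t}. B q)"
    by (auto simp: Inf_less_iff)
  also have "\<dots> \<in> sets (F t)"
  proof (rule sets.countable_UN'')
    show "countable {q\<in>rat_times. q < t}"
      by (rule countable_subset[OF _ countable_rat_times]) auto
    show "B q \<in> sets (F t)" if "q \<in> {q\<in>rat_times. q < t}" for q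
      using assms[of q] sets_F_mono[of q t, OF less_imp_le] that by auto
  qed
  finally show "{\<omega>\<in>\<Omega>. Inf {q\<in>rat_times. \<omega> \<in> B q} < t} \<in> sets (F t)" .
qed

text \<open>Strict events commute with infima, so the criterion through \<open>T < q\<close>, and
  with it the right continuity of the filtration, is what makes this work.\<close>

lemma stopping_time_INF:
  fixes U :: "nat \<Rightarrow> 'a \<Rightarrow> ennreal"
  assumes "\<And>n. stopping_time F (U n)"
  shows "stopping_time F (\<lambda>\<omega>. INF n. U n \<omega>)"
proof (rule stopping_timeI_rat_less)
  fix t :: ennreal
  have "{\<omega>\<in>\<Omega>. (INF n. U n \<omega>) < t} = (\<Union>n. {\<omega>\<in>\<Omega>. U n \<omega> < t})"
    by (auto simp: INF_less_iff)
  also have "\<dots> \<in> sets (F t)"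
    using stopping_time_less_const[OF assms] by (auto simp: pred_def space_F)
  finally show "{\<omega>\<in>\<Omega>. (INF n. U n \<omega>) < t} \<in> sets (F t)" .
qed

text \<open>Once the minimum is known to be at most \<open>t\<close>, the comparison of
  \<open>R\<close> and \<open>U\<close> can be read off from their truncations at \<open>t\<close>,
  which are \<open>F t\<close>-measurable.\<close>

lemma stopping_time_le_sets:
  assumes "stopping_time F R" "stopping_time F U"
  shows "{\<omega>\<in>\<Omega>. R \<omega> \<le> U \<omega> \<and> R \<omega> < \<infinity>} \<in> sets (pre_sigma (\<lambda>\<omega>. min (R \<omega>) (U \<omega>)))"
proof (rule sets_pre_sigmaI)
  show "stopping_time F (\<lambda>\<omega>. min (R \<omega>) (U \<omega>))"
    using assms by (rule stopping_time_min)
  fix t :: ennreal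
  have *: "(\<lambda>\<omega>. min (T \<omega>) t) \<in> borel_measurable (F t)" if "stopping_time F T" for T
  proof (rule borel_measurableI_le)
    fix s
    show "{\<omega> \<in> space (F t). min (T \<omega>) t \<le> s} \<in> sets (F t)"
      using stopping_time_le_const[OF that, of s t]
      by (cases "s < t") (auto simp: pred_def min_le_iff_disj not_less)
  qed
  note [measurable] = *[OF assms(1)] *[OF assms(2)] stopping_time_le_const[OF assms(1) order_refl]
    stopping_time_less_const[OF assms(1), of t]
  \<comment> \<open>For finite \<open>t\<close> the bound \<open>R \<le> t\<close> already makes
    \<open>R\<close> finite; the last clause on the right retains finiteness when \<open>t\<close>
    is \<infinity>.\<close>
  have "{\<omega>\<in>\<Omega>. R \<omega> \<le> U \<omega> \<and> R \<omega> < \<infinity> \<and> min (R \<omega>) (U \<omega>) \<le> t} =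
    {\<omega>\<in>space (F t). R \<omega> \<le> t \<and> min (R \<omega>) t \<le> min (U \<omega>) t \<and> (t = \<infinity> \<longrightarrow> R \<omega> < t)}"
  proof -
    have "R \<omega> \<le> U \<omega> \<and> R \<omega> < \<infinity> \<and> min (R \<omega>) (U \<omega>) \<le> t \<longleftrightarrow>
      R \<omega> \<le> t \<and> min (R \<omega>) t \<le> min (U \<omega>) t \<and> (t = \<infinity> \<longrightarrow> R \<omega> < t)" for \<omega>
      by (cases "t = \<infinity>") (auto simp: min_absorb1 less_top[symmetric] top_unique)
    then show ?thesis by (simp only: space_F)
  qed
  also have "\<dots> \<in> sets (F t)"
    by measurable
  finally show "{\<omega> \<in> {\<omega>\<in>\<Omega>. R \<omega> \<le> U \<omega> \<and> R \<omega> < \<infinity>}. min (R \<omega>) (U \<omega>) \<le> t} \<in> sets (F t)"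
    by (simp add: conj_ac)
qed

text \<open>Maximise the expectation of a bounded strictly decreasing function of \<open>U\<close>.
  Closure under countable infima makes the supremum attained, and lowering a maximiser further
  cannot change it on a set of positive probability.\<close>

lemma ess_minimum_exists:
  fixes \<U> :: "('a \<Rightarrow> ennreal) set"
  assumes ne: "\<U> \<noteq> {}" and meas: "\<U> \<subseteq> borel_measurable Q"
    and INF: "\<And>U. (\<And>n::nat. U n \<in> \<U>) \<Longrightarrow> (\<lambda>\<omega>. INF n. U n \<omega>) \<in> \<U>"
  shows "\<exists>T\<in>\<U>. \<forall>U\<in>\<U>. AE \<omega> in Q. T \<omega> \<le> U \<omega>"
proof -
  \<comment> \<open>\<open>\<phi>\<close> is 1/(1+x), extended by 0 at \<infinity>: strictly
    decreasing with values in [0,1], so all expectations are finite even where \<open>U\<close> is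
    infinite.\<close>
  define \<phi> where "\<phi> x = (if x = \<top> then 0 else 1 / (1 + enn2real x))" for x :: ennreal
  have \<phi>_anti: "\<phi> y \<le> \<phi> x" if "x \<le> y" for x y
    using that enn2real_mono[OF that] enn2real_nonneg[of x]
    by (auto simp: \<phi>_def less_top top_unique intro!: divide_left_mono mult_pos_pos add_pos_nonneg)
  have \<phi>_inj: "x = y" if "\<phi> x = \<phi> y" for x y
    using that enn2real_nonneg[of x] enn2real_nonneg[of y]
    by (cases x; cases y) (auto simp: \<phi>_def split: if_splits)
  have \<phi>_bound: "0 \<le> \<phi> x" "\<phi> x \<le> 1" for x
    by (auto simp: \<phi>_def divide_le_eq add_pos_nonneg)
  have [measurable]: "\<phi> \<in> borel_measurable borel"
    unfolding \<phi>_def by measurable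
  have int: "integrable Q (\<lambda>\<omega>. \<phi> (U \<omega>))" if "U \<in> \<U>" for U
    using that meas \<phi>_bound by (intro integrable_const_bound[where B=1]) auto
  let ?I = "\<lambda>U. \<integral>\<omega>. \<phi> (U \<omega>) \<partial>Q"
  have bdd: "bdd_above (?I ` \<U>)"
    using int \<phi>_bound by (intro bdd_aboveI2[of _ _ 1] integral_le_const) auto
  define s where "s = (SUP U\<in>\<U>. ?I U)"
  have "\<exists>U\<in>\<U>. s - 1 / Suc n < ?I U" for n :: nat
    using less_cSUP_iff[OF ne bdd, of "s - 1 / Suc n"] by (auto simp: s_def)
  then obtain U where U: "\<And>n::nat. U n \<in> \<U>" "\<And>n. s - 1 / Suc n < ?I (U n)"
    by metis
  define T where "T = (\<lambda>\<omega>. INF n. U n \<omega>)"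
  have T: "T \<in> \<U>"
    unfolding T_def by (rule INF) (rule U)
  have "s \<le> ?I T"
  proof (rule field_le_epsilon)
    fix e :: real assume "0 < e"
    then obtain n :: nat where n: "1 / Suc n < e"
      by (meson nat_approx_posE)
    have "?I (U n) \<le> ?I T"
      by (intro integral_mono int T U \<phi>_anti) (auto simp: T_def intro: INF_lower)
    with U(2)[of n] n show "s \<le> ?I T + e" by simp
  qed
  show ?thesis
  proof (intro bexI[OF _ T] ballI)
    fix V assume V: "V \<in> \<U>"
    \<comment> \<open>This is the minimum of \<open>T\<close> and \<open>V\<close>, written as a
      countable infimum so that the closure hypothesis applies.\<close>
    define W where "W = (\<lambda>\<omega>. INF n. (if n = (0::nat) then T else V) \<omega>)"
    have W: "W \<in> \<U>"
      unfolding W_def using T V by (intro INF) auto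
    have W_le: "W \<omega> \<le> T \<omega>" "W \<omega> \<le> V \<omega>" for \<omega>
      unfolding W_def by (auto intro: INF_lower2[of 0] INF_lower2[of 1])
    have "?I T \<le> ?I W"
      by (intro integral_mono int T W \<phi>_anti W_le)
    moreover have "?I W \<le> s"
      unfolding s_def by (rule cSUP_upper[OF W bdd])
    ultimately have "?I T = ?I W"
      using \<open>s \<le> ?I T\<close> by simp
    then have "AE \<omega> in Q. \<phi> (T \<omega>) = \<phi> (W \<omega>)"
      by (intro integral_ineq_eq_0_then_AE int T W AE_I2 \<phi>_anti W_le)
    then show "AE \<omega> in Q. T \<omega> \<le> V \<omega>"
      by eventually_elim (metis \<phi>_inj W_le(2))
  qed
qed

end

subsection \<open>Density processes\<close>

lemma
  assumes "sets \<nu> = sets \<mu>"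
  shows space_mean_measure: "space (mean_measure \<mu> \<nu>) = space \<mu>"
    and sets_mean_measure: "sets (mean_measure \<mu> \<nu>) = sets \<mu>"
    and emeasure_mean_measure: "A \<in> sets \<mu> \<Longrightarrow>
      emeasure (mean_measure \<mu> \<nu>) A = (emeasure \<mu> A + emeasure \<nu> A) / 2"
proof -
  show "space (mean_measure \<mu> \<nu>) = space \<mu>" "sets (mean_measure \<mu> \<nu>) = sets \<mu>"
    unfolding mean_measure_def by (simp_all add: sets.space_closed sets.sigma_sets_eq)
  assume "A \<in> sets \<mu>"
  then show "emeasure (mean_measure \<mu> \<nu>) A = (emeasure \<mu> A + emeasure \<nu> A) / 2"
    unfolding mean_measure_def
  proof (intro emeasure_measure_of_sigma sets.sigma_algebra_axioms)
    show "positive (sets \<mu>) (\<lambda>A. (emeasure \<mu> A + emeasure \<nu> A) / 2)"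
      by (simp add: positive_def)
    show "countably_additive (sets \<mu>) (\<lambda>A. (emeasure \<mu> A + emeasure \<nu> A) / 2)"
    proof (rule countably_additiveI)
      fix A :: "nat \<Rightarrow> 'a set"
      assume A: "range A \<subseteq> sets \<mu>" "disjoint_family A"
      have "(\<Sum>i. (emeasure \<mu> (A i) + emeasure \<nu> (A i)) / 2) =
          ((\<Sum>i. emeasure \<mu> (A i)) + (\<Sum>i. emeasure \<nu> (A i))) / 2"
        by (simp add: divide_ennreal_def ennreal_suminf_multc suminf_add)
      also have "\<dots> = (emeasure \<mu> (\<Union>i. A i) + emeasure \<nu> (\<Union>i. A i)) / 2"
        using A assms by (simp add: suminf_emeasure)
      finally show "(\<Sum>i. (emeasure \<mu> (A i) + emeasure \<nu> (A i)) / 2) =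
          (emeasure \<mu> (\<Union>i. A i) + emeasure \<nu> (\<Union>i. A i)) / 2" .
    qed
  qed
qed

context right_continuous_filtration
begin

lemma density_process_measurable:
  assumes "density_process Q F \<mu> z" "s \<le> t" "s < \<infinity>"
  shows "z s \<in> borel_measurable (F t)"
proof -
  have "z s \<in> borel_measurable (F s)"
    using assms by (auto simp: density_process_def)
  moreover have "subalgebra (F t) (F s)"
    using sets_F_mono[OF assms(2)] by (simp add: subalgebra_def space_F)
  ultimately show ?thesis
    using measurable_from_subalg by blast
qed

lemma emeasure_density_process:
  assumes z: "density_process Q F \<mu> z" and \<mu>: "sets \<mu> = sets (F \<infinity>)"
    and t: "t < \<infinity>" and A: "A \<in> sets (F t)"
  shows "emeasure \<mu> A = (\<integral>\<^sup>+\<omega>\<in>A. ennreal (z t \<omega>) \<partial>Q)"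
proof -
  note sub = subalgebra_F[OF sets_Q, of t]
  have [measurable]: "z t \<in> borel_measurable (F t)"
    by (rule density_process_measurable[OF z _ t]) simp
  have "emeasure \<mu> A = emeasure (restr_to_subalg \<mu> (F t)) A"
    using emeasure_restr_to_subalg[OF subalgebra_F[OF \<mu>] A] by simp
  also have "\<dots> = emeasure (density (restr_to_subalg Q (F t)) (\<lambda>\<omega>. ennreal (z t \<omega>))) A"
    using z t by (simp add: density_process_def)
  also have "\<dots> = (\<integral>\<^sup>+\<omega>\<in>A. ennreal (z t \<omega>) \<partial>restr_to_subalg Q (F t))"
    using A by (intro emeasure_density) (auto simp: sets_restr_to_subalg[OF sub] intro!: measurable_in_subalg[OF sub])
  also have "\<dots> = (\<integral>\<^sup>+\<omega>\<in>A. ennreal (z t \<omega>) \<partial>Q)"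
    using A by (intro nn_integral_subalgebra2[OF sub]) auto
  finally show ?thesis .
qed

text \<open>Doob's maximal inequality for the supermartingale \<open>1 / z\<close> under \<open>\<mu>\<close>.\<close>

lemma density_process_maximal_inequality:
  assumes z: "density_process Q F \<mu> z" and \<mu>: "sets \<mu> = sets (F \<infinity>)"
    and e: "0 \<le> e" and X: "finite X" "X \<subseteq> {..<\<infinity>}"
  shows "emeasure \<mu> {\<omega>\<in>\<Omega>. \<exists>q\<in>X. z q \<omega> < e} \<le> ennreal e * emeasure Q {\<omega>\<in>\<Omega>. \<exists>q\<in>X. z q \<omega> < e}"
  using X
proof (induction X rule: finite_linorder_max_induct)
  case empty
  then show ?case by simp
next
  case (insert b X)
  let ?C = "{\<omega>\<in>\<Omega>. \<exists>q\<in>X. z q \<omega> < e}"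
  \<comment> \<open>The induction adds a time \<open>b\<close> beyond all of \<open>X\<close>, so
    \<open>?D\<close> is the event that \<open>b\<close> is the first time with a value below
    \<open>e\<close>. It lies in \<open>F b\<close>, where \<open>z b\<close> is the density, and
    \<open>z b < e\<close> on it.\<close>
  let ?D = "{\<omega>\<in>\<Omega>. z b \<omega> < e \<and> \<not> (\<exists>q\<in>X. z q \<omega> < e)}"
  have [measurable]: "z q \<in> borel_measurable (F b)" if "q = b \<or> q \<in> X" for q
    using insert that by (intro density_process_measurable[OF z]) (auto simp: less_imp_le)
  have "{\<omega>\<in>space (F b). \<exists>q\<in>X. z q \<omega> < e} \<in> sets (F b)"
    using insert(1) by (intro sets.sets_Collect_finite_Ex) measurable
  then have C: "?C \<in> sets (F b)"
    by (simp add: space_F)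
  have "{\<omega>\<in>space (F b). z b \<omega> < e} \<in> sets (F b)"
    by measurable
  then have "{\<omega>\<in>\<Omega>. z b \<omega> < e} - ?C \<in> sets (F b)"
    using C by (auto simp: space_F)
  also have "{\<omega>\<in>\<Omega>. z b \<omega> < e} - ?C = ?D"
    by auto
  finally have D: "?D \<in> sets (F b)" .
  have F_top: "A \<in> sets (F \<infinity>)" if "A \<in> sets (F b)" for A
    using sets_F_mono[of b \<infinity>] that by auto
  have U: "{\<omega>\<in>\<Omega>. \<exists>q\<in>insert b X. z q \<omega> < e} = ?C \<union> ?D"
    by auto
  have "emeasure \<mu> ?D = (\<integral>\<^sup>+\<omega>\<in>?D. ennreal (z b \<omega>) \<partial>Q)"
    using insert D by (intro emeasure_density_process[OF z \<mu>]) auto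
  also have "\<dots> \<le> (\<integral>\<^sup>+\<omega>. ennreal e * indicator ?D \<omega> \<partial>Q)"
    by (intro nn_integral_mono) (auto split: split_indicator intro: ennreal_leI)
  also have "\<dots> = ennreal e * emeasure Q ?D"
    using F_top[OF D] by (intro nn_integral_cmult_indicator) (simp add: sets_Q)
  finally have *: "emeasure \<mu> ?D \<le> ennreal e * emeasure Q ?D" .
  have "emeasure \<mu> (?C \<union> ?D) = emeasure \<mu> ?C + emeasure \<mu> ?D"
    using F_top[OF C] F_top[OF D] by (intro plus_emeasure[symmetric]) (auto simp: \<mu>)
  also have "\<dots> \<le> ennreal e * emeasure Q ?C + ennreal e * emeasure Q ?D"
    using insert by (intro add_mono *) auto
  also have "\<dots> = ennreal e * emeasure Q (?C \<union> ?D)"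
    using F_top[OF C] F_top[OF D]
    by (subst plus_emeasure[symmetric]) (auto simp: sets_Q distrib_left[symmetric])
  finally show ?case
    unfolding U .
qed

text \<open>The finite initial pieces of an enumeration of \<open>D\<close> give increasing events;
  the maximal inequality bounds each by \<open>e\<close>, since \<open>Q\<close> has total mass 1,
  and continuity from below passes to \<open>D\<close>.\<close>

lemma density_process_small_values:
  assumes z: "density_process Q F \<mu> z" and \<mu>: "sets \<mu> = sets (F \<infinity>)" and e: "0 \<le> e"
    and D: "countable D" "D \<subseteq> {..<\<infinity>}"
  shows "emeasure \<mu> {\<omega>\<in>\<Omega>. \<exists>q\<in>D. z q \<omega> < e} \<le> ennreal e"
proof (cases "D = {}")
  case False
  let ?r = "from_nat_into D"
  have D_eq: "D = range ?r"
    using D False by simp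
  let ?A = "\<lambda>n. {\<omega>\<in>\<Omega>. \<exists>q\<in>?r ` {..<n}. z q \<omega> < e}"
  have "?A n \<in> sets \<mu>" for n
  proof -
    have "{\<omega>\<in>space (F \<infinity>). \<exists>q\<in>?r ` {..<n}. z q \<omega> < e} \<in> sets (F \<infinity>)"
    proof (rule sets.sets_Collect_finite_Ex)
      fix q assume "q \<in> ?r ` {..<n}"
      then have "q < \<infinity>" using D D_eq by auto
      then have [measurable]: "z q \<in> borel_measurable (F \<infinity>)"
        by (intro density_process_measurable[OF z]) auto
      show "{\<omega>\<in>space (F \<infinity>). z q \<omega> < e} \<in> sets (F \<infinity>)"
        by measurable
    qed simp
    then show ?thesis by (simp add: space_F \<mu>)
  qed
  moreover have "incseq ?A"
    by (auto simp: incseq_def intro: less_le_trans)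
  ultimately have "(SUP n. emeasure \<mu> (?A n)) = emeasure \<mu> (\<Union>n. ?A n)"
    by (intro SUP_emeasure_incseq) (simp_all add: image_subset_iff)
  also have "(\<Union>n. ?A n) = {\<omega>\<in>\<Omega>. \<exists>q\<in>D. z q \<omega> < e}"
    by (subst (2) D_eq) blast
  finally have eq: "emeasure \<mu> {\<omega>\<in>\<Omega>. \<exists>q\<in>D. z q \<omega> < e} = (SUP n. emeasure \<mu> (?A n))" ..
  have "emeasure \<mu> (?A n) \<le> ennreal e" for n
  proof -
    have "emeasure \<mu> (?A n) \<le> ennreal e * emeasure Q (?A n)"
      using D D_eq by (intro density_process_maximal_inequality[OF z \<mu> e]) auto
    also have "\<dots> \<le> ennreal e * 1"
      by (intro mult_left_mono emeasure_le_1) auto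
    finally show ?thesis by simp
  qed
  then show ?thesis
    unfolding eq by (rule SUP_least)
qed simp

text \<open>The event that \<open>z\<close> gets arbitrarily small at rational times up to
  \<open>t\<close> is \<mu>-null by the previous bound. It lies in \<open>F t\<close>, so its
  \<mu>-measure is the \<open>Q\<close>-integral of \<open>z t\<close> over it, and
  \<open>z t\<close> must vanish there almost surely.\<close>

lemma AE_zero_absorbing:
  assumes z: "density_process Q F \<mu> z" and \<mu>: "sets \<mu> = sets (F \<infinity>)"
  shows "AE \<omega> in Q. zero_absorbing (\<lambda>t. z t \<omega>)"
proof -
  have "AE \<omega> in Q. (\<forall>e>0. \<exists>q\<in>rat_times. q \<le> t \<and> z q \<omega> < e) \<longrightarrow> z t \<omega> = 0"
    if t: "t \<in> rat_times" for t
  proof -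
    have tfin: "t < \<infinity>" using t by (rule rat_times_finite)
    let ?D = "{q\<in>rat_times. q \<le> t}"
    have D: "countable ?D" "?D \<subseteq> {..<\<infinity>}"
      using rat_times_finite by (auto intro: countable_subset[OF _ countable_rat_times])
    let ?E = "\<lambda>n::nat. {\<omega>\<in>\<Omega>. \<exists>q\<in>?D. z q \<omega> < 1 / Suc n}"
    let ?C = "\<Inter>n. ?E n"
    have E: "?E n \<in> sets (F t)" for n
    proof -
      have "{\<omega>\<in>space (F t). \<exists>q\<in>?D. z q \<omega> < 1 / Suc n} \<in> sets (F t)"
      proof (rule sets.sets_Collect_countable_Ex'[OF _ D(1)])
        fix q assume "q \<in> ?D"
        then have [measurable]: "z q \<in> borel_measurable (F t)"
          using D(2) by (intro density_process_measurable[OF z]) auto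
        show "{\<omega>\<in>space (F t). z q \<omega> < 1 / Suc n} \<in> sets (F t)"
          by measurable
      qed
      then show ?thesis by (simp add: space_F)
    qed
    then have C: "?C \<in> sets (F t)"
      by auto
    have F_top: "A \<in> sets (F \<infinity>)" if "A \<in> sets (F t)" for A
      using sets_F_mono[of t \<infinity>] that by auto
    have "emeasure \<mu> ?C \<le> 0 + ennreal e" if e: "0 < e" for e
    proof -
      obtain n :: nat where n: "1 / Suc n < e"
        using nat_approx_posE[OF e] by blast
      have "emeasure \<mu> ?C \<le> emeasure \<mu> (?E n)"
        using F_top[OF E] by (intro emeasure_mono) (auto simp: \<mu>)
      also have "\<dots> \<le> ennreal (1 / Suc n)"
        by (rule density_process_small_values[OF z \<mu> _ D]) simp
      also have "\<dots> \<le> ennreal e"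
        using n by (intro ennreal_leI) simp
      finally show ?thesis by simp
    qed
    then have "emeasure \<mu> ?C = 0"
      using ennreal_le_epsilon[of 0 "emeasure \<mu> ?C"] by auto
    then have *: "(\<integral>\<^sup>+\<omega>\<in>?C. ennreal (z t \<omega>) \<partial>Q) = 0"
      using emeasure_density_process[OF z \<mu> tfin C] by simp
    have [measurable]: "z t \<in> borel_measurable Q" "?C \<in> sets Q"
      using density_process_measurable[OF z _ tfin, of \<infinity>] F_top[OF C] measurable_cong_sets[OF sets_Q refl]
      by (auto simp: sets_Q)
    have "(\<lambda>\<omega>. ennreal (z t \<omega>) * indicator ?C \<omega>) \<in> borel_measurable Q"
      by measurable
    then have "AE \<omega> in Q. ennreal (z t \<omega>) * indicator ?C \<omega> = 0"
      using * by (rule nn_integral_0_iff_AE[THEN iffD1])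
    moreover have "AE \<omega> in Q. 0 \<le> z t \<omega>"
      using z tfin by (simp add: density_process_def)
    ultimately show ?thesis
      using AE_space
    proof eventually_elim
      case (elim \<omega>)
      show ?case
      proof
        assume "\<forall>e>0. \<exists>q\<in>rat_times. q \<le> t \<and> z q \<omega> < e"
        then have "\<exists>q\<in>rat_times. q \<le> t \<and> z q \<omega> < 1 / Suc n" for n :: nat
          by simp
        then have "\<omega> \<in> ?C"
          using elim(3) by (auto simp: space_Q)
        with elim show "z t \<omega> = 0" by (auto simp: ennreal_eq_0_iff)
      qed
    qed
  qed
  then have "AE \<omega> in Q. \<forall>t\<in>rat_times. (\<forall>e>0. \<exists>q\<in>rat_times. q \<le> t \<and> z q \<omega> < e) \<longrightarrow> z t \<omega> = 0"
    unfolding AE_ball_countable[OF countable_rat_times] by (rule ballI)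
  then show ?thesis
    by (simp add: zero_absorbing_def)
qed

end

section \<open>The two densities together, and a stopping time version of \<open>S\<close> on
  \<open>N\<close>\<close>

locale density_pair = right_continuous_filtration Q \<Omega> F
  for Q :: "'a measure" and \<Omega> :: "'a set" and F :: "ennreal \<Rightarrow> 'a measure" +
  fixes \<mu> \<nu> :: "'a measure" and z z' :: "ennreal \<Rightarrow> 'a \<Rightarrow> real"
  assumes sets_\<mu>: "sets \<mu> = sets (F \<infinity>)" and sets_\<nu>: "sets \<nu> = sets (F \<infinity>)"
    and emeasure_Q: "A \<in> sets (F \<infinity>) \<Longrightarrow> emeasure \<mu> A + emeasure \<nu> A = 2 * emeasure Q A"
    and density_z: "density_process Q F \<mu> z" and density_z': "density_process Q F \<nu> z'"
begin

abbreviation "S \<equiv> zero_time z z'"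
abbreviation "N \<equiv> N1 \<Omega> z z'"

text \<open>On \<open>F t\<close> both the sum of the densities and the constant 2 are densities of
  \<mu> + \<nu> with respect to \<open>Q\<close>, and such densities are almost surely
  unique.\<close>

lemma AE_densities_sum:
  assumes t: "t < \<infinity>"
  shows "AE \<omega> in Q. z t \<omega> + z' t \<omega> = 2"
proof -
  note sub = subalgebra_F[OF sets_Q, of t]
  let ?M = "restr_to_subalg Q (F t)"
  interpret M: prob_space ?M
    using sub prob_space_axioms by (rule prob_space_restr_to_subalg)
  have m: "z t \<in> borel_measurable (F t)" "z' t \<in> borel_measurable (F t)"
    using density_process_measurable[OF density_z _ t] density_process_measurable[OF density_z' _ t]
    by auto
  note [measurable] = m measurable_in_subalg[OF sub m(1)] measurable_in_subalg[OF sub m(2)]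
    measurable_from_subalg[OF sub m(1)] measurable_from_subalg[OF sub m(2)]
  have "density ?M (\<lambda>\<omega>. ennreal (z t \<omega>) + ennreal (z' t \<omega>)) = density ?M (\<lambda>\<omega>. 2)"
  proof (rule measure_eqI)
    fix A assume "A \<in> sets (density ?M (\<lambda>\<omega>. ennreal (z t \<omega>) + ennreal (z' t \<omega>)))"
    then have A: "A \<in> sets (F t)" and AM: "A \<in> sets ?M"
      by (simp_all add: sets_restr_to_subalg[OF sub])
    have AI: "A \<in> sets (F \<infinity>)"
      using A sets_F_mono[of t \<infinity>] by auto
    then have [measurable]: "A \<in> sets Q"
      by (simp add: sets_Q)
    have "emeasure (density ?M (\<lambda>\<omega>. ennreal (z t \<omega>) + ennreal (z' t \<omega>))) A =
        (\<integral>\<^sup>+\<omega>\<in>A. (ennreal (z t \<omega>) + ennreal (z' t \<omega>)) \<partial>?M)"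
      using AM by (intro emeasure_density) measurable
    also have "\<dots> = (\<integral>\<^sup>+\<omega>\<in>A. (ennreal (z t \<omega>) + ennreal (z' t \<omega>)) \<partial>Q)"
      using A by (intro nn_integral_subalgebra2[OF sub]) auto
    also have "\<dots> = (\<integral>\<^sup>+\<omega>\<in>A. ennreal (z t \<omega>) \<partial>Q) + (\<integral>\<^sup>+\<omega>\<in>A. ennreal (z' t \<omega>) \<partial>Q)"
      unfolding distrib_right by (intro nn_integral_add) measurable
    also have "\<dots> = 2 * emeasure Q A"
      using emeasure_density_process[OF density_z sets_\<mu> t A]
        emeasure_density_process[OF density_z' sets_\<nu> t A] emeasure_Q[OF AI] by simp
    also have "\<dots> = emeasure (density ?M (\<lambda>\<omega>. 2)) A"
      using emeasure_restr_to_subalg[OF sub A] AM by (simp add: emeasure_density_const)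
    finally show "emeasure (density ?M (\<lambda>\<omega>. ennreal (z t \<omega>) + ennreal (z' t \<omega>))) A =
      emeasure (density ?M (\<lambda>\<omega>. 2)) A" .
  qed simp
  then have "AE \<omega> in ?M. ennreal (z t \<omega>) + ennreal (z' t \<omega>) = 2"
    by (subst (asm) M.density_unique_iff) measurable
  then have "AE \<omega> in Q. ennreal (z t \<omega>) + ennreal (z' t \<omega>) = 2"
    by (rule AE_restr_to_subalg[OF sub])
  moreover have "AE \<omega> in Q. 0 \<le> z t \<omega>" "AE \<omega> in Q. 0 \<le> z' t \<omega>"
    using density_z density_z' t by (auto simp: density_process_def)
  ultimately show ?thesis
  proof eventually_elim
    case (elim \<omega>)
    then have "ennreal (z t \<omega> + z' t \<omega>) = ennreal 2"
      by simp
    with elim(2,3) show ?case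
      by (subst (asm) ennreal_inj) auto
  qed
qed

lemma AE_regular_pair: "AE \<omega> in Q. regular_pair z z' \<omega>"
proof -
  have "AE \<omega> in Q. 0 \<le> z q \<omega> \<and> 0 \<le> z' q \<omega> \<and> z q \<omega> + z' q \<omega> = 2" if "q \<in> rat_times" for q
    using AE_densities_sum[of q] density_z density_z' rat_times_finite[OF that]
    by (auto simp: density_process_def)
  then have "AE \<omega> in Q. \<forall>q\<in>rat_times. 0 \<le> z q \<omega> \<and> 0 \<le> z' q \<omega> \<and> z q \<omega> + z' q \<omega> = 2"
    unfolding AE_ball_countable[OF countable_rat_times] by (rule ballI)
  moreover have "AE \<omega> in Q. cadlag_path (\<lambda>t. z t \<omega>)" "AE \<omega> in Q. cadlag_path (\<lambda>t. z' t \<omega>)"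
    using density_z density_z' by (auto simp: density_process_def)
  ultimately show ?thesis
    using AE_zero_absorbing[OF density_z sets_\<mu>] AE_zero_absorbing[OF density_z' sets_\<nu>]
    by eventually_elim (intro regular_pairI_rat; simp)
qed

text \<open>
  As the filtration is not complete, \<open>S\<close> restricted to \<open>N\<close> is only almost surely equal to a
  stopping time.
\<close>

lemma stopping_time_version:
  obtains R where "stopping_time F R" "AE \<omega> in Q. R \<omega> = restrict_time S N \<omega>"
proof
  \<comment> \<open>On regular paths \<open>B t\<close> is the event that \<open>N\<close> occurs
    and \<open>S < t\<close>, in the form that uses \<open>z'\<close> at rational times before
    \<open>t\<close> only and is therefore \<open>F t\<close>-measurable.\<close>
  define B where "B t = {\<omega>\<in>\<Omega>. (\<exists>q\<in>{q\<in>rat_times. q < t}. z' q \<omega> = 0) \<and>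
    (\<exists>n::nat. \<exists>p\<in>{p\<in>rat_times. p < t}. 0 < z' p \<omega> \<and>
       (\<forall>q\<in>{q\<in>rat_times. p \<le> q \<and> q < t}. z' q \<omega> = 0 \<or> 1 / Suc n \<le> z' q \<omega>))}" for t
  define R where "R \<omega> = Inf {q\<in>rat_times. \<omega> \<in> B q}" for \<omega>
  have "B t \<in> sets (F t)" for t
  proof -
    have z'_sets: "{\<omega>\<in>space (F t). z' q \<omega> = 0} \<in> sets (F t)" "{\<omega>\<in>space (F t). 0 < z' q \<omega>} \<in> sets (F t)"
      "{\<omega>\<in>space (F t). c \<le> z' q \<omega>} \<in> sets (F t)"
      if "q \<in> rat_times" "q < t" for q c
    proof -
      have [measurable]: "z' q \<in> borel_measurable (F t)"
        using that rat_times_finite by (intro density_process_measurable[OF density_z']) auto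
      show "{\<omega>\<in>space (F t). z' q \<omega> = 0} \<in> sets (F t)" "{\<omega>\<in>space (F t). 0 < z' q \<omega>} \<in> sets (F t)"
        "{\<omega>\<in>space (F t). c \<le> z' q \<omega>} \<in> sets (F t)"
        by measurable
    qed
    have c: "countable {q\<in>rat_times. P q}" for P
      by (rule countable_subset[OF _ countable_rat_times]) auto
    show ?thesis
      unfolding B_def space_F[of t, symmetric]
      by (intro sets.sets_Collect_conj sets.sets_Collect_disj sets.sets_Collect_countable_Ex
          sets.sets_Collect_countable_Ex' sets.sets_Collect_countable_All' c z'_sets) auto
  qed
  then show "stopping_time F R"
    unfolding R_def[abs_def] by (intro stopping_time_from_rat_events)
  show "AE \<omega> in Q. R \<omega> = restrict_time S N \<omega>"
    using AE_regular_pair AE_space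
  proof eventually_elim
    case (elim \<omega>)
    have B_iff: "\<omega> \<in> B q \<longleftrightarrow> \<omega> \<in> N \<and> S \<omega> < q" if "q \<in> rat_times" for q
      using N1_before_iff[OF elim(1) _ rat_times_finite[OF that], of \<Omega>] elim(2)
      by (simp add: B_def space_Q Bex_def Ball_def conj_assoc imp_conjL)
    show ?case
    proof (cases "\<omega> \<in> N")
      case True
      have "R \<omega> = S \<omega>"
      proof (rule antisym)
        show "R \<omega> \<le> S \<omega>"
        proof (rule ccontr)
          assume "\<not> R \<omega> \<le> S \<omega>"
          then obtain q where q: "q \<in> rat_times" "S \<omega> < q" "q < R \<omega>"
            using rat_times_dense[of "S \<omega>" "R \<omega>"] by (auto simp: not_le)
          then have "R \<omega> \<le> q"
            unfolding R_def using B_iff True by (intro Inf_lower) auto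
          with q show False by simp
        qed
        show "S \<omega> \<le> R \<omega>"
          unfolding R_def using B_iff by (intro Inf_greatest) (auto intro: less_imp_le)
      qed
      with True show ?thesis by (simp add: restrict_time_def)
    next
      case False
      \<comment> \<open>The infimum of the empty set is \<infinity>, which is the value of
        \<open>restrict_time\<close> off \<open>N\<close>.\<close>
      then have "{q\<in>rat_times. \<omega> \<in> B q} = {}"
        using B_iff by auto
      then show ?thesis
        using False unfolding R_def by (simp only: Inf_empty restrict_time_def if_False infinity_ennreal_def)
    qed
  qed
qed

end

subsection \<open>The compensator on rectangles\<close>

text \<open>Each truncation of \<open>a\<close> is a finite increasing right-continuous function,
  whose measure gives the half-open interval its increment. The supremum over truncations stays
  outside the difference because \<open>a s\<close> may be \<infinity>.\<close>

lemma stieltjes_nn_integral_Ioc: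
  fixes a :: "ennreal \<Rightarrow> ennreal"
  assumes mono: "mono_on {..<\<infinity>} a" and rc: "\<And>t. t < \<infinity> \<Longrightarrow> continuous (at_right t) a"
    and st: "s \<le> t" "t < \<infinity>"
  shows "stieltjes_nn_integral a (\<lambda>r. c * indicator {s<..t} r) =
    c * (SUP n::nat. min (a t) (of_nat n) - min (a s) (of_nat n))"
proof -
  obtain s' where s': "s = ennreal s'" "0 \<le> s'"
    using st by (cases s) auto
  obtain t' where t': "t = ennreal t'" "0 \<le> t'"
    using st by (cases t) auto
  have le: "s' \<le> t'" using st(1) s' t' by (simp add: ennreal_le_iff)
  have "(\<integral>\<^sup>+r\<in>{0<..}. (c * indicator {s<..t} (ennreal r))
      \<partial>interval_measure (\<lambda>r. enn2real (min (a (ennreal r)) (of_nat n)))) =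
    c * (min (a t) (of_nat n) - min (a s) (of_nat n))" (is "?I = _") for n :: nat
  proof -
    define G where "G r = enn2real (min (a (ennreal r)) (of_nat n))" for r
    have G: "ennreal (G r) = min (a (ennreal r)) (of_nat n)" for r
      unfolding G_def by (intro ennreal_enn2real) (auto simp: min_less_iff_disj of_nat_less_top)
    have G_mono: "G x \<le> G y" if "x \<le> y" for x y
      unfolding G_def using mono that
      by (intro enn2real_mono min.mono)
         (auto simp: mono_on_def ennreal_leI min_less_iff_disj of_nat_less_top)
    have G_rc: "continuous (at_right r) G" for r
    proof (cases "r < 0")
      case True
      \<comment> \<open>\<open>ennreal\<close> maps negative reals to 0, so \<open>G\<close> is
        constant to the left of 0.\<close>
      have "eventually (\<lambda>x. G x = G r) (at_right r)"
        using True by (auto simp: eventually_at_right_field G_def ennreal_neg intro!: exI[of _ 0])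
      then show ?thesis
        unfolding continuous_within by (rule tendsto_eventually)
    next
      case False
      have "filterlim ennreal (at_right (ennreal r)) (at_right r)"
        unfolding filterlim_at
      proof
        show "((\<lambda>x. ennreal x) \<longlongrightarrow> ennreal r) (at_right r)"
          by (intro tendsto_intros)
        show "\<forall>\<^sub>F x in at_right r. ennreal x \<in> {ennreal r<..} \<and> ennreal x \<noteq> ennreal r"
          using False by (auto simp: eventually_at_right_field ennreal_less_iff intro!: exI[of _ "r + 1"])
      qed
      moreover have "(a \<longlongrightarrow> a (ennreal r)) (at_right (ennreal r))"
        using rc[of "ennreal r"] by (simp add: continuous_within)
      ultimately have "((\<lambda>x. a (ennreal x)) \<longlongrightarrow> a (ennreal r)) (at_right r)"
        by (rule filterlim_compose[rotated])
      then have "((\<lambda>x. min (a (ennreal x)) (of_nat n)) \<longlongrightarrow> ennreal (G r)) (at_right r)"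
        unfolding G by (intro tendsto_min tendsto_const)
      then show ?thesis
        unfolding continuous_within by (subst G_def[abs_def], intro tendsto_enn2real) (simp_all add: G_def)
    qed
    have "?I = (\<integral>\<^sup>+r. c * indicator {s'<..t'} r \<partial>interval_measure G)"
      unfolding G_def[symmetric] using s' t'
      by (intro nn_integral_cong) (auto simp: ennreal_less_iff ennreal_le_iff2 split: split_indicator)
    also have "\<dots> = c * ennreal (G t' - G s')"
      using le by (simp add: nn_integral_cmult_indicator emeasure_interval_measure_Ioc G_mono G_rc)
    also have "ennreal (G t' - G s') = ennreal (G t') - ennreal (G s')"
      by (intro ennreal_minus[symmetric]) (simp add: G_def)
    finally show ?thesis
      unfolding G s' t' .
  qed
  then show ?thesis
    unfolding stieltjes_nn_integral_def by (simp add: SUP_mult_left_ennreal)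
qed

text \<open>Truncation is essential: in \<open>ennreal\<close> the difference \<infinity> -
  \<infinity> is \<infinity>, not 0.\<close>

lemma truncated_diff_self [simp]: "min (x::ennreal) (of_nat n) - min x (of_nat n) = 0"
  by (simp add: diff_eq_0_iff_ennreal min_less_iff_disj of_nat_less_top)

text \<open>If \<open>y < x\<close>, a level \<open>n\<close> above some \<open>w\<close> strictly
  between them still separates the two truncations, also when \<open>x\<close> is
  \<infinity>.\<close>

lemma SUP_truncated_diff_eq_0:
  fixes x y :: ennreal
  assumes "y \<le> x" "(SUP n::nat. min x (of_nat n) - min y (of_nat n)) = 0"
  shows "x = y"
proof (rule ccontr)
  assume "x \<noteq> y"
  with assms(1) have "y < x" by simp
  then obtain w where w: "y < w" "w < x" using dense by blast
  have "w < \<top>"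
    using w(2) top_greatest by (rule less_le_trans)
  then obtain n :: nat where n: "w < of_nat n"
    using ennreal_Ex_less_of_nat by auto
  have "min x (of_nat n) - min y (of_nat n) \<le> 0"
    unfolding assms(2)[symmetric] by (rule SUP_upper) simp
  then have "min x (of_nat n) \<le> min y (of_nat n)"
    by (simp add: diff_eq_0_iff_ennreal min_less_iff_disj)
  also have "min y (of_nat n) < w"
    using w by (simp add: min_less_iff_disj)
  also have "w < min x (of_nat n)"
    using w n by simp
  finally show False .
qed

section \<open>Predictable rectangles\<close>

context right_continuous_filtration
begin

definition predictable_rectangles :: "('a \<times> ennreal) set set" where
  "predictable_rectangles = {B \<times> {0} | B. B \<in> sets (F 0)} \<union>
      {B \<times> {s<..t} | B s t. B \<in> sets (F s) \<and> s \<le> t \<and> t < \<infinity>}"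

lemma predictable_rectanglesE:
  assumes "Y \<in> predictable_rectangles"
  obtains B I where "Y = B \<times> I" "B \<in> sets Q" "B \<subseteq> \<Omega>" "I \<subseteq> {..<\<infinity>}"
proof -
  have sub: "B \<subseteq> \<Omega>" "B \<in> sets Q" if "B \<in> sets (F s)" for B s
    using sets.sets_into_space[OF that] sets_F_mono[of s \<infinity>] that by (auto simp: space_F sets_Q)
  from assms consider B where "Y = B \<times> {0}" "B \<in> sets (F 0)"
    | B s t where "Y = B \<times> {s<..t}" "B \<in> sets (F s)" "t < \<infinity>"
    unfolding predictable_rectangles_def by blast
  then show thesis
  proof cases
    case 1
    then show ?thesis using sub by (intro that[of B "{0}"]) auto
  next
    case 2
    then have "{s<..t} \<subseteq> {..<\<infinity>}"
      by (meson greaterThanAtMost_iff le_less_trans lessThan_iff subsetI)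
    with 2 show ?thesis using sub by (intro that[of B "{s<..t}"]) auto
  qed
qed

lemma predictable_rectangles_Pow: "predictable_rectangles \<subseteq> Pow (\<Omega> \<times> {..<\<infinity>})"
  by (blast elim: predictable_rectanglesE)

lemma predictable_sigma_eq: "predictable_sigma \<Omega> F = sigma (\<Omega> \<times> {..<\<infinity>}) predictable_rectangles"
  unfolding predictable_sigma_def predictable_rectangles_def ..

text \<open>The preimage of a rectangle under the section map at time \<open>t\<close> is its base
  or empty. Measurability of \<open>h t\<close> is needed later to conclude from vanishing
  integrals.\<close>

lemma measurable_predictable_section:
  assumes "(\<lambda>(\<omega>, t). h t \<omega>) \<in> borel_measurable (predictable_sigma \<Omega> F)" "t < \<infinity>"
  shows "h t \<in> borel_measurable Q"
proof -
  have "(\<lambda>\<omega>. (\<omega>, t)) \<in> Q \<rightarrow>\<^sub>M predictable_sigma \<Omega> F"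
    unfolding predictable_sigma_eq
  proof (rule measurable_measure_of[OF predictable_rectangles_Pow])
    show "(\<lambda>\<omega>. (\<omega>, t)) \<in> space Q \<rightarrow> \<Omega> \<times> {..<\<infinity>}"
      using assms(2) by (auto simp: space_Q)
    fix Y assume "Y \<in> predictable_rectangles"
    then obtain B I where Y: "Y = B \<times> I" "B \<in> sets Q"
      by (rule predictable_rectanglesE)
    then have "(\<lambda>\<omega>. (\<omega>, t)) -` Y \<inter> space Q = (if t \<in> I then B else {})"
      using sets.sets_into_space[OF Y(2)] by auto
    then show "(\<lambda>\<omega>. (\<omega>, t)) -` Y \<inter> space Q \<in> sets Q"
      using Y(2) by simp
  qed
  from measurable_compose[OF this assms(1)] show ?thesis
    by simp
qed

lemma predictable_rectangle:
  assumes "B \<in> sets (F s)" "s \<le> t" "t < \<infinity>"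
  shows "(indicator (B \<times> {s<..t}) :: _ \<Rightarrow> ennreal) \<in> borel_measurable (predictable_sigma \<Omega> F)"
proof (rule borel_measurable_indicator)
  have "B \<times> {s<..t} \<in> predictable_rectangles"
    using assms unfolding predictable_rectangles_def by blast
  then show "B \<times> {s<..t} \<in> sets (predictable_sigma \<Omega> F)"
    unfolding predictable_sigma_eq sets_measure_of[OF predictable_rectangles_Pow]
    by (rule sigma_sets.Basic)
qed

text \<open>The defining identity is tested with the indicator of \<open>B \<times> {s<..t}\<close>.
  The paths of \<open>h\<close> are regular only almost surely, hence the interval formula is
  applied to them under the integral.\<close>

lemma compensator_rectangle:
  assumes comp: "compensator Q F A h"
    and A: "\<And>\<omega>. mono_on {..<\<infinity>} (\<lambda>t. A t \<omega>)"
      "\<And>\<omega> t. t < \<infinity> \<Longrightarrow> continuous (at_right t) (\<lambda>t. A t \<omega>)"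
    and B: "B \<in> sets (F s)" and st: "s \<le> t" "t < \<infinity>"
  shows "(\<integral>\<^sup>+\<omega>. indicator B \<omega> * (SUP n::nat. min (A t \<omega>) (of_nat n) - min (A s \<omega>) (of_nat n)) \<partial>Q) =
    (\<integral>\<^sup>+\<omega>. indicator B \<omega> * (SUP n::nat. min (h t \<omega>) (of_nat n) - min (h s \<omega>) (of_nat n)) \<partial>Q)"
    (is "?a = ?b")
proof -
  let ?H = "indicator (B \<times> {s<..t}) :: 'a \<times> ennreal \<Rightarrow> ennreal"
  have "?a = (\<integral>\<^sup>+\<omega>. stieltjes_nn_integral (\<lambda>t. A t \<omega>) (\<lambda>r. ?H (\<omega>, r)) \<partial>Q)"
    by (simp only: indicator_times fst_conv snd_conv stieltjes_nn_integral_Ioc[OF A(1) A(2) st])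
  also have "\<dots> = (\<integral>\<^sup>+\<omega>. stieltjes_nn_integral (\<lambda>t. h t \<omega>) (\<lambda>r. ?H (\<omega>, r)) \<partial>Q)"
    using comp predictable_rectangle[OF B st] unfolding compensator_def space_Q by blast
  also have "\<dots> = ?b"
  proof (rule nn_integral_cong_AE)
    have "AE \<omega> in Q. mono_on {..<\<infinity>} (\<lambda>t. h t \<omega>) \<and> (\<forall>t<\<infinity>. continuous (at_right t) (\<lambda>s. h s \<omega>))"
      using comp by (simp add: compensator_def)
    then show "AE \<omega> in Q. stieltjes_nn_integral (\<lambda>t. h t \<omega>) (\<lambda>r. ?H (\<omega>, r)) =
       indicator B \<omega> * (SUP n::nat. min (h t \<omega>) (of_nat n) - min (h s \<omega>) (of_nat n))"
      by eventually_elim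
        (simp only: indicator_times fst_conv snd_conv stieltjes_nn_integral_Ioc[OF _ _ st])
  qed
  finally show ?thesis .
qed

end

text \<open>The path is a single upward step that takes its new value already at the zero time, so
  it is constant shortly after every \<open>t\<close>.\<close>

lemma A1_path_regular:
  "mono_on {..<\<infinity>} (\<lambda>t. A1 \<Omega> z z' t \<omega>)" "t < \<infinity> \<Longrightarrow> continuous (at_right t) (\<lambda>t. A1 \<Omega> z z' t \<omega>)"
proof -
  let ?S = "zero_time z z' \<omega>"
  show "mono_on {..<\<infinity>} (\<lambda>t. A1 \<Omega> z z' t \<omega>)"
    by (auto simp: mono_on_def A1_def split: split_indicator)
  assume t: "t < \<infinity>"
  have "eventually (\<lambda>s. A1 \<Omega> z z' s \<omega> = A1 \<Omega> z z' t \<omega>) (at_right t)"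
    unfolding ennreal_eventually_at_right[OF t]
  proof (cases "?S \<le> t")
    case True
    then show "\<exists>b>t. \<forall>s. t < s \<longrightarrow> s < b \<longrightarrow> A1 \<Omega> z z' s \<omega> = A1 \<Omega> z z' t \<omega>"
      using t by (intro exI[of _ \<infinity>]) (auto simp: A1_def split: split_indicator)
  next
    case False
    then show "\<exists>b>t. \<forall>s. t < s \<longrightarrow> s < b \<longrightarrow> A1 \<Omega> z z' s \<omega> = A1 \<Omega> z z' t \<omega>"
      by (intro exI[of _ ?S]) (auto simp: A1_def split: split_indicator)
  qed
  then show "continuous (at_right t) (\<lambda>t. A1 \<Omega> z z' t \<omega>)"
    unfolding continuous_within by (rule tendsto_eventually)
qed

subsection \<open>Stopping the compensator\<close>

text \<open>With a rational \<open>b\<close> beyond \<open>t\<close>, monotonicity and constancy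
  give \<open>f t \<le> f b = f q\<close> for rational \<open>q\<close> between \<open>u\<close> and
  \<open>t\<close>; letting \<open>q\<close> decrease to \<open>u\<close> bounds \<open>f t\<close>
  by \<open>f u\<close>.\<close>

lemma right_continuous_constant_after:
  fixes f :: "ennreal \<Rightarrow> ennreal"
  assumes "mono_on {..<\<infinity>} f" "continuous (at_right u) f" "u < t" "t < \<infinity>"
    and const: "\<And>a b. a \<in> rat_times \<Longrightarrow> b \<in> rat_times \<Longrightarrow> u \<le> a \<Longrightarrow> a < b \<Longrightarrow> f a = f b"
  shows "f t = f u"
proof (rule antisym)
  have "u < \<infinity>" using assms(3,4) by (rule less_trans)
  obtain b where b: "b \<in> rat_times" "t < b"
    using rat_times_dense[OF assms(4)] by auto
  have "f u \<in> {f t..}"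
  proof (rule rat_times_right_limit_in_closed[OF \<open>u < \<infinity>\<close> assms(3,2)])
    fix q assume q: "q \<in> rat_times" "u < q" "q < t"
    have "f t \<le> f b"
      using b assms(1,4) rat_times_finite[OF b(1)] by (auto simp: mono_on_def less_imp_le)
    also have "f b = f q"
      using const[OF q(1) b(1)] q b by (simp add: less_imp_le less_trans[OF q(3) b(2)])
    finally show "f q \<in> {f t..}" by simp
  qed simp
  then show "f t \<le> f u" by simp
  show "f u \<le> f t"
    using assms(1,3,4) \<open>u < \<infinity>\<close> by (auto simp: mono_on_def less_imp_le)
qed

lemma compensator_path_regular:
  assumes "compensator Q F A h"
  shows "AE \<omega> in Q. mono_on {..<\<infinity>} (\<lambda>t. h t \<omega>) \<and>
    (\<forall>t<\<infinity>. continuous (at_right t) (\<lambda>s. h s \<omega>))"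
  using assms by (simp add: compensator_def)

context density_pair
begin

text \<open>On the event \<open>U \<le> s\<close> the increments of \<open>A1\<close> and
  \<open>h\<close> over \<open>{s<..t}\<close> have equal expectations. If one process is constant
  after \<open>U\<close>, the nonnegative increments of the other vanish almost surely; rational
  \<open>s\<close> and \<open>t\<close> keep the exceptional sets countable.\<close>

lemma stopped_by_iff:
  assumes comp: "compensator Q F (A1 \<Omega> z z') h" and U: "stopping_time F U"
  shows "stopped_by Q h U \<longleftrightarrow> (AE \<omega> in Q. \<omega> \<in> N \<longrightarrow> S \<omega> \<le> U \<omega>)"
proof -
  let ?B = "\<lambda>s. {\<omega>\<in>\<Omega>. U \<omega> \<le> s}"
  let ?D = "\<lambda>X s t \<omega>. SUP n::nat. min (X t \<omega> :: ennreal) (of_nat n) - min (X s \<omega>) (of_nat n)"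
  have B: "?B s \<in> sets (F s)" for s
    using stopping_timeD[OF U, of s] by (simp add: pred_def space_F)
  have B_Q[measurable]: "?B s \<in> sets Q" for s
    using B[of s] sets_F_mono[of s \<infinity>] by (auto simp: sets_Q)
  have rect: "(\<integral>\<^sup>+\<omega>. indicator (?B s) \<omega> * ?D (A1 \<Omega> z z') s t \<omega> \<partial>Q) =
      (\<integral>\<^sup>+\<omega>. indicator (?B s) \<omega> * ?D h s t \<omega> \<partial>Q)" if "s \<le> t" "t < \<infinity>" for s t
    by (rule compensator_rectangle[OF comp A1_path_regular B that])
  have h_meas: "h t \<in> borel_measurable Q" if "t < \<infinity>" for t
    using comp that by (intro measurable_predictable_section) (simp_all add: compensator_def space_Q)
  show ?thesis
  proof
    assume st: "stopped_by Q h U"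
    obtain R where R: "stopping_time F R" "AE \<omega> in Q. R \<omega> = restrict_time S N \<omega>"
      by (rule stopping_time_version)
    note [measurable] = stopping_time_measurable[OF R(1)] stopping_time_measurable[OF U]
    have "AE \<omega> in Q. \<not> (U \<omega> \<le> s \<and> s < R \<omega> \<and> R \<omega> \<le> t)"
      if q: "s \<in> rat_times" "t \<in> rat_times" for s t
    proof (cases "s \<le> t")
      case True
      note fin = rat_times_finite[OF q(1)] rat_times_finite[OF q(2)]
      \<comment> \<open>\<open>R\<close> replaces \<open>S\<close> on \<open>N\<close> because it is
        measurable, and its value \<infinity> off \<open>N\<close> makes \<open>R \<le> t\<close>
        imply membership in \<open>N\<close> almost surely.\<close>
      let ?E = "{\<omega>\<in>space Q. U \<omega> \<le> s \<and> s < R \<omega> \<and> R \<omega> \<le> t}"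
      have "(\<integral>\<^sup>+\<omega>. indicator ?E \<omega> \<partial>Q) \<le> (\<integral>\<^sup>+\<omega>. indicator (?B s) \<omega> * ?D (A1 \<Omega> z z') s t \<omega> \<partial>Q)"
      proof (rule nn_integral_mono_AE)
        show "AE \<omega> in Q. indicator ?E \<omega> \<le> indicator (?B s) \<omega> * ?D (A1 \<Omega> z z') s t \<omega>"
          using R(2) AE_regular_pair
        proof eventually_elim
          case (elim \<omega>)
          show ?case
          proof (cases "\<omega> \<in> ?E")
            case True
            then have N: "\<omega> \<in> N" and S: "R \<omega> = S \<omega>"
              using elim(1) fin(2) by (auto simp: restrict_time_def top_unique split: if_splits)
            have "1 \<le> z (S \<omega>) \<omega> / left_limit z (S \<omega>) \<omega>"
              using N1_jump[OF elim(2) N] .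
            then have "ennreal 1 \<le> ennreal (z (S \<omega>) \<omega> / left_limit z (S \<omega>) \<omega>)"
              by (rule ennreal_leI)
            \<comment> \<open>Already the truncation level 1 of the supremum suffices:
              \<open>A1\<close> is 0 at \<open>s\<close> and at least 1 at \<open>t\<close>.\<close>
            then have "1 = min (A1 \<Omega> z z' t \<omega>) (of_nat 1) - min (A1 \<Omega> z z' s \<omega>) (of_nat 1)"
              using True N S by (simp add: A1_def min_absorb2 indicator_def not_le[symmetric])
            also have "\<dots> \<le> ?D (A1 \<Omega> z z') s t \<omega>"
              by (rule SUP_upper) simp
            finally show ?thesis
              using True by (simp add: space_Q)
          qed simp
        qed
      qed
      also have "\<dots> = (\<integral>\<^sup>+\<omega>. indicator (?B s) \<omega> * ?D h s t \<omega> \<partial>Q)"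
        using True fin by (intro rect)
      also have "\<dots> = (\<integral>\<^sup>+\<omega>. 0 \<partial>Q)"
      proof (rule nn_integral_cong_AE)
        show "AE \<omega> in Q. indicator (?B s) \<omega> * ?D h s t \<omega> = 0"
          using st unfolding stopped_by_def
        proof eventually_elim
          case (elim \<omega>)
          show ?case
          proof (cases "U \<omega> \<le> s")
            case U: True
            have "h t \<omega> = h (U \<omega>) \<omega>" "h s \<omega> = h (U \<omega>) \<omega>"
              using elim[rule_format, OF fin(1)] elim[rule_format, OF fin(2)] U True
              by (auto simp: min_absorb2)
            then show ?thesis
              by simp
          qed simp
        qed
      qed
      finally have "emeasure Q ?E = 0"
        by simp
      moreover have "?E \<in> sets Q"
        by measurable
      ultimately have "AE \<omega> in Q. \<omega> \<notin> ?E"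
        by (intro AE_not_in) (auto simp: null_sets_def)
      then show ?thesis
        using AE_space by eventually_elim simp
    next
      case False
      then have "\<not> (s < R \<omega> \<and> R \<omega> \<le> t)" for \<omega>
        using less_le_trans[of s "R \<omega>" t] less_imp_le[of s t] by blast
      then show ?thesis by simp
    qed
    then have "AE \<omega> in Q. \<forall>s\<in>rat_times. \<forall>t\<in>rat_times. \<not> (U \<omega> \<le> s \<and> s < R \<omega> \<and> R \<omega> \<le> t)"
      unfolding AE_ball_countable[OF countable_rat_times] by (intro ballI)
    then show "AE \<omega> in Q. \<omega> \<in> N \<longrightarrow> S \<omega> \<le> U \<omega>"
      using R(2)
    proof eventually_elim
      case (elim \<omega>)
      show ?case
      proof (intro impI, rule ccontr)
        assume N: "\<omega> \<in> N" and "\<not> S \<omega> \<le> U \<omega>"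
        then have "U \<omega> < S \<omega>" "S \<omega> < \<infinity>" "R \<omega> = S \<omega>"
          using elim(2) by (auto simp: N1_def restrict_time_def not_le)
        with rat_times_dense[of "U \<omega>" "S \<omega>"] rat_times_dense[of "S \<omega>" \<infinity>]
        obtain s t where "s \<in> rat_times" "U \<omega> < s" "s < S \<omega>" "t \<in> rat_times" "S \<omega> < t"
          by auto
        then have "U \<omega> \<le> s" "s < R \<omega>" "R \<omega> \<le> t"
          using \<open>R \<omega> = S \<omega>\<close> by (simp_all add: less_imp_le)
        with elim(1) \<open>s \<in> rat_times\<close> \<open>t \<in> rat_times\<close> show False
          by blast
      qed
    qed
  next
    assume null: "AE \<omega> in Q. \<omega> \<in> N \<longrightarrow> S \<omega> \<le> U \<omega>"
    have "AE \<omega> in Q. U \<omega> \<le> s \<longrightarrow> s < t \<longrightarrow> h s \<omega> = h t \<omega>"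
      if q: "s \<in> rat_times" "t \<in> rat_times" for s t
    proof (cases "s < t")
      case True
      note fin = rat_times_finite[OF q(1)] rat_times_finite[OF q(2)]
      note [measurable] = h_meas[OF fin(1)] h_meas[OF fin(2)]
      have "(\<integral>\<^sup>+\<omega>. indicator (?B s) \<omega> * ?D h s t \<omega> \<partial>Q) =
          (\<integral>\<^sup>+\<omega>. indicator (?B s) \<omega> * ?D (A1 \<Omega> z z') s t \<omega> \<partial>Q)"
        using True fin by (intro rect[symmetric]) auto
      also have "\<dots> = (\<integral>\<^sup>+\<omega>. 0 \<partial>Q)"
      proof (rule nn_integral_cong_AE)
        show "AE \<omega> in Q. indicator (?B s) \<omega> * ?D (A1 \<Omega> z z') s t \<omega> = 0"
          using null
        proof eventually_elim
          case (elim \<omega>)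
          show ?case
          proof (cases "U \<omega> \<le> s")
            case U: True
            have "A1 \<Omega> z z' t \<omega> = A1 \<Omega> z z' s \<omega>"
            proof (cases "\<omega> \<in> N")
              case N: True
              then have "S \<omega> \<le> s" "S \<omega> \<le> t"
                using elim U True by auto
              then show ?thesis by (simp add: A1_def)
            qed (simp add: A1_def)
            then show ?thesis
              by simp
          qed simp
        qed
      qed
      finally have "(\<integral>\<^sup>+\<omega>. indicator (?B s) \<omega> * ?D h s t \<omega> \<partial>Q) = 0"
        by simp
      moreover have "(\<lambda>\<omega>. indicator (?B s) \<omega> * ?D h s t \<omega>) \<in> borel_measurable Q"
        by measurable
      \<comment> \<open>A nonnegative measurable integrand with integral 0 vanishes almost
        surely.\<close>
      ultimately have "AE \<omega> in Q. indicator (?B s) \<omega> * ?D h s t \<omega> = 0"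
        by (rule nn_integral_0_iff_AE[THEN iffD1, rotated])
      then show ?thesis
        using compensator_path_regular[OF comp] AE_space
      proof eventually_elim
        case (elim \<omega>)
        show ?case
        proof (intro impI)
          assume "U \<omega> \<le> s"
          then have D0: "?D h s t \<omega> = 0"
            using elim(1,3) by (simp add: space_Q)
          have "h s \<omega> \<le> h t \<omega>"
            using elim(2) fin less_imp_le[OF True] by (intro mono_onD[of "{..<\<infinity>}" "\<lambda>t. h t \<omega>"]) simp_all
          then show "h s \<omega> = h t \<omega>"
            using D0 by (rule SUP_truncated_diff_eq_0[symmetric])
        qed
      qed
    qed simp
    then have "AE \<omega> in Q. \<forall>s\<in>rat_times. \<forall>t\<in>rat_times. U \<omega> \<le> s \<longrightarrow> s < t \<longrightarrow> h s \<omega> = h t \<omega>"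
      unfolding AE_ball_countable[OF countable_rat_times] by (intro ballI)
    then show "stopped_by Q h U"
      unfolding stopped_by_def using compensator_path_regular[OF comp]
    proof eventually_elim
      case (elim \<omega>)
      show ?case
      proof (intro allI impI)
        fix t :: ennreal assume t: "t < \<infinity>"
        show "h t \<omega> = h (min t (U \<omega>)) \<omega>"
        proof (cases "U \<omega> < t")
          case True
          have "h t \<omega> = h (U \<omega>) \<omega>"
          proof (rule right_continuous_constant_after[where f = "\<lambda>t. h t \<omega>", OF _ _ True t])
            show "mono_on {..<\<infinity>} (\<lambda>t. h t \<omega>)" "continuous (at_right (U \<omega>)) (\<lambda>t. h t \<omega>)"
              using elim(2) less_trans[OF True t] by blast+
            show "h a \<omega> = h b \<omega>" if "a \<in> rat_times" "b \<in> rat_times" "U \<omega> \<le> a" "a < b" for a b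
              using elim(1) that by blast
          qed
          with True show ?thesis by (simp add: min_absorb2 less_imp_le)
        qed (simp add: min_absorb1 not_less)
      qed
    qed
  qed
qed

section \<open>The least stopping time of \<open>h\<close> and the essential infimum\<close>

lemma stopped_by_INF:
  fixes U :: "nat \<Rightarrow> 'a \<Rightarrow> ennreal"
  assumes comp: "compensator Q F (A1 \<Omega> z z') h"
    and U: "\<And>n. stopping_time F (U n)" "\<And>n. stopped_by Q h (U n)"
  shows "stopped_by Q h (\<lambda>\<omega>. INF n. U n \<omega>)"
proof -
  have "AE \<omega> in Q. \<forall>n. \<omega> \<in> N \<longrightarrow> S \<omega> \<le> U n \<omega>"
    unfolding AE_all_countable using U stopped_by_iff[OF comp] by blast
  then have "AE \<omega> in Q. \<omega> \<in> N \<longrightarrow> S \<omega> \<le> (INF n. U n \<omega>)"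
    by eventually_elim (auto intro: INF_greatest)
  then show ?thesis
    by (simp add: stopped_by_iff[OF comp stopping_time_INF[OF U(1)]])
qed

text \<open>The stopping times that stop \<open>h\<close> include the constant \<infinity> and are
  closed under countable infima, so an essential minimum exists within the family.\<close>

lemma stopping_time_of_compensator_exists:
  assumes comp: "compensator Q F (A1 \<Omega> z z') h"
  obtains T where "stopping_time_of_process Q F h T"
proof -
  let ?\<U> = "{U. stopping_time F U \<and> stopped_by Q h U}"
  have "(\<lambda>_. \<infinity>) \<in> ?\<U>"
    by (simp add: stopped_by_def stopping_time_const)
  then have "\<exists>T\<in>?\<U>. \<forall>U\<in>?\<U>. AE \<omega> in Q. T \<omega> \<le> U \<omega>"
    using stopped_by_INF[OF comp]
    by (intro ess_minimum_exists) (auto intro: stopping_time_measurable stopping_time_INF)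
  then show ?thesis
    using that by (auto simp: stopping_time_of_process_def)
qed

lemma H1_family_stopped:
  assumes comp: "compensator Q F (A1 \<Omega> z z') h" and W: "W \<in> H1_family Q F z z'"
  shows "stopping_time F W" "stopped_by Q h W"
proof -
  show st: "stopping_time F W"
    using W by (simp add: H1_family_def)
  have "AE \<omega> in Q. restrict_time W N \<omega> = restrict_time S N \<omega>"
    using W by (simp add: H1_family_def space_Q)
  then have "AE \<omega> in Q. \<omega> \<in> N \<longrightarrow> S \<omega> \<le> W \<omega>"
    by eventually_elim (auto simp: restrict_time_def)
  then show "stopped_by Q h W"
    by (simp add: stopped_by_iff[OF comp st])
qed

text \<open>The member is \<open>min R U\<close>. On \<open>N\<close> it equals \<open>S\<close>,
  since \<open>S \<le> U\<close> there by the stopping criterion.\<close>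

lemma H1_family_below_stopped:
  assumes comp: "compensator Q F (A1 \<Omega> z z') h" and U: "stopping_time F U" "stopped_by Q h U"
  shows "\<exists>W\<in>H1_family Q F z z'. \<forall>\<omega>. W \<omega> \<le> U \<omega>"
proof -
  obtain R where R: "stopping_time F R" "AE \<omega> in Q. R \<omega> = restrict_time S N \<omega>"
    by (rule stopping_time_version)
  let ?W = "\<lambda>\<omega>. min (R \<omega>) (U \<omega>)"
  \<comment> \<open>This event represents \<open>N\<close> up to a null set: on \<open>N\<close> the
    finite time \<open>R = S\<close> is at most \<open>U\<close>, and off \<open>N\<close> the time
    \<open>R\<close> is \<infinity>.\<close>
  let ?B = "{\<omega>\<in>\<Omega>. R \<omega> \<le> U \<omega> \<and> R \<omega> < \<infinity>}"
  have "AE \<omega> in Q. \<omega> \<in> N \<longrightarrow> S \<omega> \<le> U \<omega>"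
    using U by (simp add: stopped_by_iff[OF comp])
  with R(2) have "AE \<omega> in Q. (\<omega> \<in> N \<longleftrightarrow> \<omega> \<in> ?B) \<and> restrict_time ?W N \<omega> = restrict_time S N \<omega>"
    using AE_space
  proof eventually_elim
    case (elim \<omega>)
    show ?case
    proof (cases "\<omega> \<in> N")
      case True
      then have "R \<omega> = S \<omega>" "S \<omega> < \<infinity>" "S \<omega> \<le> U \<omega>" "\<omega> \<in> \<Omega>"
        using elim by (simp_all add: restrict_time_def N1_def)
      with True show ?thesis
        by (simp add: restrict_time_def min_absorb1)
    next
      case False
      then show ?thesis
        using elim(1) by (simp add: restrict_time_def)
    qed
  qed
  then have "AE \<omega> in Q. \<omega> \<in> N \<longleftrightarrow> \<omega> \<in> ?B" "AE \<omega> in Q. restrict_time ?W N \<omega> = restrict_time S N \<omega>"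
    unfolding AE_conj_iff by (rule conjunct1, rule conjunct2)
  then have "?W \<in> H1_family Q F z z'"
    using stopping_time_le_sets[OF R(1) U(1)] stopping_time_min[OF R(1) U(1)]
    unfolding H1_family_def in_sets_mod_null_def space_Q mem_Collect_eq
    by (intro conjI bexI[of _ ?B]; simp only: mem_Collect_eq)
  then show ?thesis
    by (rule bexI[rotated]) simp
qed

text \<open>Each member of the family stops \<open>h\<close>, so \<open>T\<close> is a lower bound.
  Conversely some member lies below \<open>T\<close> itself, and every other lower bound lies below
  that member.\<close>

lemma is_ess_inf_H1_family:
  assumes comp: "compensator Q F (A1 \<Omega> z z') h" and T: "stopping_time_of_process Q F h T"
  shows "is_ess_inf Q (H1_family Q F z z') T"
  unfolding is_ess_inf_def
proof (intro conjI ballI impI)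
  have T': "stopping_time F T" "stopped_by Q h T"
    using T by (auto simp: stopping_time_of_process_def)
  then show "T \<in> borel_measurable Q"
    by (intro stopping_time_measurable)
  show "AE \<omega> in Q. T \<omega> \<le> W \<omega>" if "W \<in> H1_family Q F z z'" for W
    using T H1_family_stopped[OF comp that] by (simp add: stopping_time_of_process_def)
  fix G assume G: "\<forall>W\<in>H1_family Q F z z'. AE \<omega> in Q. G \<omega> \<le> W \<omega>"
  obtain W where W: "W \<in> H1_family Q F z z'" "\<And>\<omega>. W \<omega> \<le> T \<omega>"
    using H1_family_below_stopped[OF comp T'] by blast
  from G W(1) have "AE \<omega> in Q. G \<omega> \<le> W \<omega>" by blast
  then show "AE \<omega> in Q. G \<omega> \<le> T \<omega>"
    by eventually_elim (rule order_trans[OF _ W(2)])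
qed

end

lemma is_ess_inf_unique:
  assumes "is_ess_inf Q \<W> G" "is_ess_inf Q \<W> H"
  shows "AE \<omega> in Q. G \<omega> = H \<omega>"
proof -
  have "AE \<omega> in Q. G \<omega> \<le> H \<omega>" "AE \<omega> in Q. H \<omega> \<le> G \<omega>"
    using assms by (auto simp: is_ess_inf_def)
  then show ?thesis
    by eventually_elim simp
qed

theorem proposition1:
  fixes \<Omega> :: "'a set" and F :: "ennreal \<Rightarrow> 'a measure"
    and \<mu> \<nu> Q :: "'a measure"
    and z z' :: "ennreal \<Rightarrow> 'a \<Rightarrow> real" and h :: "ennreal \<Rightarrow> 'a \<Rightarrow> ennreal"
  assumes "filtered_space \<Omega> F"
    and "prob_space \<mu>" and "sets \<mu> = sets (F \<infinity>)"
    and "prob_space \<nu>" and "sets \<nu> = sets (F \<infinity>)"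
    and "Q = mean_measure \<mu> \<nu>"
    and "density_process Q F \<mu> z"
    and "density_process Q F \<nu> z'"
    and "compensator Q F (A1 \<Omega> z z') h"
  shows "(\<exists>H. is_ess_inf Q (H1_family Q F z z') H) \<and>
    (\<forall>H. is_ess_inf Q (H1_family Q F z z') H \<longrightarrow>
      (\<exists>T. (AE \<omega> in Q. T \<omega> = H \<omega>) \<and> stopping_time_of_process Q F h T))"
proof -
  have sets: "sets \<nu> = sets \<mu>"
    using assms(3,5) by simp
  have half: "2 * (x / 2) = x" for x :: ennreal
    by (simp add: ennreal_times_divide mult.commute[of 2] mult_divide_eq_ennreal)
  have Q: "2 * emeasure Q A = emeasure \<mu> A + emeasure \<nu> A" if "A \<in> sets \<mu>" for A
    unfolding assms(6) emeasure_mean_measure[OF sets that] by (rule half)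
  have "emeasure \<mu> (space \<mu>) = 1" "emeasure \<nu> (space \<mu>) = 1"
    using prob_space.emeasure_space_1[OF assms(2)] prob_space.emeasure_space_1[OF assms(4)]
      sets_eq_imp_space_eq[OF sets] by simp_all
  then have "emeasure Q (space Q) = 1"
    unfolding assms(6) space_mean_measure[OF sets] emeasure_mean_measure[OF sets sets.top]
    by (simp add: ennreal_divide_self)
  then interpret prob_space Q
    by (rule prob_spaceI)
  interpret density_pair Q \<Omega> F \<mu> \<nu> z z'
    using assms(1,3,5,7,8) Q sets_mean_measure[OF sets]
    by (intro density_pair.intro right_continuous_filtration.intro prob_space_axioms
        right_continuous_filtration_axioms.intro density_pair_axioms.intro)
       (simp_all add: filtered_space_def assms(6))
  obtain T where T: "stopping_time_of_process Q F h T"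
    by (rule stopping_time_of_compensator_exists[OF assms(9)])
  have inf: "is_ess_inf Q (H1_family Q F z z') T"
    using is_ess_inf_H1_family[OF assms(9) T] .
  \<comment> \<open>Any essential infimum equals \<open>T\<close> almost surely, so \<open>T\<close>
    serves as the required version for each \<open>H\<close>.\<close>
  show ?thesis
    using T inf is_ess_inf_unique[OF inf] by blast
qed

end
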